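(* Let $k\ge 6$. If $k$ and $g$ satisfy one of the following conditions, then there exists no $(k,g)$-graph of cyclic excess $4$: 1) $k\equiv 1$ or $2 \pmod 3$ and $g=8$; 2) $k\equiv 1\pmod 3$ and $g=12$; 3) $k\equiv 1\pmod 3$ and $g=16$.
   Context: Graphs are finite and simple. A $(k,g)$-graph is a $k$-regular graph of girth $g$. For even $g=2d$ the Moore bound is $M(k,g)=2\bigl(1+(k-1)+\dots+(k-1)^{d-1}\bigr)$, and the excess of a $(k,g)$-graph of order $n$ is $n-M(k,g)$. For $k\ge 6$ and $g=2d\ge 6$, a $(k,g)$-graph $G$ of excess $4$ is bipartite of diameter $d+1$ (known theorem of Biggs and Ito). The excess graph $G(E)$ of such a graph $G$ is the graph on the vertex set of $G$ in which two vertices are adjacent if and only if their distance in $G$ is $d+1$. A $(k,g)$-graph $G$ of excess $4$ and order $n$ has cyclic excess $4$ if $G(E)$ is a single cycle of length $n$. *)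

theory Defs
  imports "Graph_Theory.Graph_Theory" "HOL-Library.Extended_Nat"
begin

text \<open>
  A finite simple graph is a \<^locale>\<open>pair_graph\<close>: a finite, loop-free, symmetric digraph without
  parallel arcs. An undirected edge is the pair of arcs \<open>(u, v)\<close>, \<open>(v, u)\<close>, so the degree
  of a vertex is its out-degree. The constant \<^const>\<open>pre_digraph.cycle\<close> also accepts the closed walk
  \<open>u, v, u\<close> along a single edge, which is not a cycle of the undirected graph; it is excluded by
  requiring length at least 3.
\<close>

definition ucycle :: "'a pair_pre_digraph \<Rightarrow> ('a \<times> 'a) awalk \<Rightarrow> bool" where
  "ucycle G p \<longleftrightarrow> pre_digraph.cycle (with_proj G) p \<and> 3 \<le> length p"

text \<open>The girth of a graph without cycles is infinite.\<close>

definition girth :: "'a pair_pre_digraph \<Rightarrow> enat" where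
  "girth G = (INF p \<in> {p. ucycle G p}. enat (length p))"

definition regular :: "nat \<Rightarrow> 'a pair_pre_digraph \<Rightarrow> bool" where
  "regular k G \<longleftrightarrow> (\<forall>v \<in> pverts G. out_degree (with_proj G) v = k)"

definition kg_graph :: "nat \<Rightarrow> nat \<Rightarrow> 'a pair_pre_digraph \<Rightarrow> bool" where
  "kg_graph k g G \<longleftrightarrow> pair_graph G \<and> regular k G \<and> girth G = enat g"

text \<open>
  The Moore bound and the notions built on it are meant for even girth \<open>g\<close> and \<open>k \<ge> 1\<close> only,
  so neither \<open>g div 2\<close> nor \<open>k - 1\<close> is truncated.
\<close>

definition moore_bound :: "nat \<Rightarrow> nat \<Rightarrow> nat" where
  "moore_bound k g = 2 * (\<Sum>i<g div 2. (k - 1) ^ i)"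

definition excess :: "nat \<Rightarrow> nat \<Rightarrow> 'a pair_pre_digraph \<Rightarrow> int" where
  "excess k g G = int (card (pverts G)) - int (moore_bound k g)"

text \<open>Distance is the cost of a shortest walk when every arc costs 1; it is infinite between
  different components.\<close>

definition udist :: "'a pair_pre_digraph \<Rightarrow> 'a \<Rightarrow> 'a \<Rightarrow> ereal" where
  "udist G u v = wf_digraph.\<mu> (with_proj G) (\<lambda>_. 1) u v"

definition excess_graph :: "nat \<Rightarrow> 'a pair_pre_digraph \<Rightarrow> 'a pair_pre_digraph" where
  "excess_graph g G =
    \<lparr> pverts = pverts G,
      parcs = {(u, v). u \<in> pverts G \<and> v \<in> pverts G \<and> udist G u v = ereal (real (g div 2 + 1))} \<rparr>"

text \<open>
  A graph is a single cycle of length \<open>n\<close> if it has \<open>n\<close> vertices and some cycle of length \<open>n\<close>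
  comprises all its edges. The cycle \<open>p\<close> lists one of the two arcs of each edge; the converse
  relation supplies the other.
\<close>

definition is_cycle_graph :: "nat \<Rightarrow> 'a pair_pre_digraph \<Rightarrow> bool" where
  "is_cycle_graph n H \<longleftrightarrow>
    card (pverts H) = n \<and>
    (\<exists>p. ucycle H p \<and> length p = n \<and> parcs H = set p \<union> (set p)\<inverse>)"

definition cyclic_excess_4 :: "nat \<Rightarrow> nat \<Rightarrow> 'a pair_pre_digraph \<Rightarrow> bool" where
  "cyclic_excess_4 k g G \<longleftrightarrow>
    kg_graph k g G \<and> excess k g G = 4 \<and> is_cycle_graph (card (pverts G)) (excess_graph g G)"

end

theory Submission
  imports Defs
begin

text \<open>
  Let \<open>q = k - 1\<close>, \<open>g = 2 d\<close>, let \<open>A\<close> be the adjacency operator of the graph and \<open>E\<close> that of the excess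
  cycle. Counting edges between distance layers shows that the diameter is \<open>d + 1\<close>, and a further
  double count shows that the graph is bipartite. As \<open>d\<close> is even, \<open>G(A) + E\<close> then sums a function
  over the opposite half, where \<open>G\<close> is a monic polynomial of degree \<open>d - 1\<close> of Chebyshev type. Since
  \<open>3\<close> divides the order \<open>n\<close>, the eigenvalue \<open>-1\<close> of the cycle \<open>E\<close> has a two-dimensional eigenspace with
  an integral basis. It is invariant under \<open>A\<close>, which therefore acts on it as an integral two by two
  matrix \<open>C\<close> with \<open>G(C) = 1\<close>. Reducing modulo \<open>3\<close> (or directly, for the cubic) shows that \<open>C\<close> is
  scalar, hence an integral root of \<open>G(x) = 1\<close>, and there is none.
\<close>

section \<open>Distance layers under a girth condition\<close>

text \<open>The sphere of radius \<open>i\<close> about \<open>u\<close>, given through walk lengths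
  alone; a vertex that cannot be reached from \<open>u\<close> lies in no layer.\<close>

definition layer :: "('a \<Rightarrow> 'a \<Rightarrow> bool) \<Rightarrow> 'a \<Rightarrow> nat \<Rightarrow> 'a set" where
  "layer R u i = {w. (R ^^ i) u w \<and> (\<forall>j<i. \<not> (R ^^ j) u w)}"

lemma layer_0 [simp]: "layer R u 0 = {u}"
  by (auto simp: layer_def)

lemma layer_unique: "w \<in> layer R u i \<Longrightarrow> w \<in> layer R u j \<Longrightarrow> i = j"
  by (auto simp: layer_def) (metis nat_neq_iff)

lemma relpowp_layer:
  assumes "(R ^^ m) u w"
  obtains j where "j \<le> m" "w \<in> layer R u j"
proof
  let ?j = "LEAST i. (R ^^ i) u w"
  show "?j \<le> m" using assms by (rule Least_le)
  show "w \<in> layer R u ?j"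
    unfolding layer_def using assms by (auto intro: LeastI dest: not_less_Least)
qed

lemma layer_step:
  assumes "x \<in> layer R u i" "R x y"
  obtains j where "j \<le> Suc i" "y \<in> layer R u j"
proof -
  have "(R ^^ Suc i) u y" using assms by (auto simp: layer_def)
  then show ?thesis by (rule relpowp_layer) (rule that)
qed

text \<open>The last vertex but one of a shortest walk lies in the layer just before, since an
  earlier layer would put \<open>x\<close> too close to \<open>u\<close>.\<close>

lemma layer_Suc_back:
  assumes "x \<in> layer R u (Suc i)"
  obtains y where "y \<in> layer R u i" "R y x"
proof -
  obtain y where y: "(R ^^ i) u y" "R y x"
    using assms by (auto simp: layer_def)
  obtain j where j: "j \<le> i" "y \<in> layer R u j"
    using relpowp_layer[OF y(1)] .
  obtain l where l: "l \<le> Suc j" "x \<in> layer R u l"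
    using layer_step[OF j(2) y(2)] .
  have "l = Suc i" using layer_unique[OF l(2) assms] .
  with l j have "j = i" by simp
  with j y that show ?thesis by simp
qed

lemma layer_geodesic:
  assumes "x \<in> layer R u i"
  obtains p where "p i = x" "\<And>j. j \<le> i \<Longrightarrow> p j \<in> layer R u j" "\<And>j. j < i \<Longrightarrow> R (p j) (p (Suc j))"
  using assms
proof (induction i arbitrary: x thesis)
  case 0
  then show ?case by (auto intro: "0.prems"(1)[of "\<lambda>_. u"])
next
  case (Suc i)
  obtain y where y: "y \<in> layer R u i" "R y x"
    using layer_Suc_back[OF Suc.prems(2)] .
  obtain p where p: "p i = y" "\<And>j. j \<le> i \<Longrightarrow> p j \<in> layer R u j"
      "\<And>j. j < i \<Longrightarrow> R (p j) (p (Suc j))"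
    using Suc.IH[OF _ y(1)] by blast
  show ?case
    by (rule Suc.prems(1)[of "p(Suc i := x)"])
       (use p y Suc.prems(2) in \<open>auto simp: le_Suc_eq less_Suc_eq\<close>)
qed

lemma relpowp_symp:
  assumes "\<And>x y. R x y \<Longrightarrow> R y x"
  shows "(R ^^ i) u w \<Longrightarrow> (R ^^ i) w u"
proof (induction i arbitrary: w)
  case (Suc i)
  then obtain y where "(R ^^ i) u y" "R y w" by auto
  then show ?case using assms Suc.IH by (meson relpowp_Suc_I2)
qed auto

text \<open>The girth condition is stated for walks without backtracking instead of cycles: two
  geodesics can then be glued into a closed walk by comparing only vertices two steps apart.\<close>

locale no_short_cycles =
  fixes V :: "'a set" and adj :: "'a \<Rightarrow> 'a \<Rightarrow> bool" and q d :: nat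
  assumes finite_V: "finite V"
    and adj_V: "adj x y \<Longrightarrow> x \<in> V"
    and adj_sym: "adj x y \<Longrightarrow> adj y x"
    and degree: "x \<in> V \<Longrightarrow> card {y. adj x y} = Suc q"
    and not_closed: "\<lbrakk>\<And>i. i < m \<Longrightarrow> adj (w i) (w (Suc i));
      \<And>i. i + 2 \<le> m \<Longrightarrow> w i \<noteq> w (i + 2); 0 < m; m < 2 * d\<rbrakk> \<Longrightarrow> w 0 \<noteq> w m"
    and d_pos: "2 \<le> d"
begin

abbreviation "D \<equiv> layer adj"

lemma adj_commute: "adj x y \<longleftrightarrow> adj y x"
  using adj_sym by blast

lemma adj_V2: "adj x y \<Longrightarrow> y \<in> V"
  using adj_V adj_sym by blast

lemma adj_irrefl: "\<not> adj x x"
  using not_closed[of 1 "\<lambda>_. x"] d_pos by auto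

lemma layer_sym: "w \<in> D u i \<longleftrightarrow> u \<in> D w i"
  unfolding layer_def using relpowp_symp[of adj, OF adj_sym] by blast

lemma layer_V: "u \<in> V \<Longrightarrow> w \<in> D u i \<Longrightarrow> w \<in> V"
  by (cases i) (auto elim!: layer_Suc_back dest: adj_V2)

lemma finite_layer: "u \<in> V \<Longrightarrow> finite (D u i)"
  by (rule finite_subset[OF _ finite_V]) (auto intro: layer_V)

lemma finite_adj: "finite {y. adj x y \<and> P y}"
  by (rule finite_subset[OF _ finite_V]) (auto dest: adj_V2)

text \<open>Geodesics from \<open>u\<close> to \<open>x\<close> and to \<open>y\<close> close up
  through the edge to a walk of length \<open>2 * i + 1\<close>, which is too short if
  \<open>i < d\<close>.\<close>

lemma no_same_layer:
  assumes "x \<in> D u i" "y \<in> D u i" "adj x y"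
  shows "d \<le> i"
proof (rule ccontr)
  assume i: "\<not> d \<le> i"
  obtain p where p: "p i = x" "\<And>j. j \<le> i \<Longrightarrow> p j \<in> D u j" "\<And>j. j < i \<Longrightarrow> adj (p j) (p (Suc j))"
    using layer_geodesic[OF assms(1)] by blast
  obtain r where r: "r i = y" "\<And>j. j \<le> i \<Longrightarrow> r j \<in> D u j" "\<And>j. j < i \<Longrightarrow> adj (r j) (r (Suc j))"
    using layer_geodesic[OF assms(2)] by blast
  define w where "w k = (if k \<le> i then p k else r (2 * i + 1 - k))" for k
  \<comment> \<open>\<open>l k\<close> is the layer of \<open>w k\<close>; it differs for indices
    two apart, which rules out backtracking.\<close>
  define l where "l k = (if k \<le> i then k else 2 * i + 1 - k)" for k
  have wl: "w k \<in> D u (l k)" if "k \<le> 2 * i + 1" for k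
    using that p r by (auto simp: w_def l_def)
  have "w 0 \<noteq> w (2 * i + 1)"
  proof (rule not_closed)
    fix k assume k: "k < 2 * i + 1"
    consider "k < i" | "k = i" | "k > i" by linarith
    then show "adj (w k) (w (Suc k))"
    proof cases
      case 3
      then have "2 * i + 1 - k = Suc (2 * i + 1 - Suc k)" using k by simp
      with 3 k r(3)[of "2 * i + 1 - Suc k"] show ?thesis by (simp add: w_def adj_commute)
    qed (use p r assms(3) in \<open>auto simp: w_def\<close>)
  next
    fix k assume k: "k + 2 \<le> 2 * i + 1"
    have "l k \<noteq> l (k + 2)" using k by (simp add: l_def) presburger
    then show "w k \<noteq> w (k + 2)"
      using wl[of k] wl[of "k + 2"] k layer_unique by (metis le_add1 le_trans)
  qed (use i in auto)
  moreover have "w 0 = u" "w (2 * i + 1) = u"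
    using p(2)[of 0] r(2)[of 0] by (auto simp: w_def)
  ultimately show False by simp
qed

text \<open>Two different predecessors of \<open>x\<close> would close two geodesics to a walk of
  length \<open>2 * i + 2\<close>. Vertices two steps apart lie in different layers, except for
  \<open>y\<close> and \<open>z\<close> on either side of \<open>x\<close>.\<close>

lemma unique_back:
  assumes "x \<in> D u (Suc i)" "y \<in> D u i" "adj x y" "z \<in> D u i" "adj x z" "Suc i < d"
  shows "y = z"
proof (rule ccontr)
  assume yz: "y \<noteq> z"
  obtain p where p: "p i = y" "\<And>j. j \<le> i \<Longrightarrow> p j \<in> D u j" "\<And>j. j < i \<Longrightarrow> adj (p j) (p (Suc j))"
    using layer_geodesic[OF assms(2)] by blast
  obtain r where r: "r i = z" "\<And>j. j \<le> i \<Longrightarrow> r j \<in> D u j" "\<And>j. j < i \<Longrightarrow> adj (r j) (r (Suc j))"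
    using layer_geodesic[OF assms(4)] by blast
  define w where "w k = (if k \<le> i then p k else if k = Suc i then x else r (2 * i + 2 - k))" for k
  define l where "l k = (if k \<le> Suc i then k else 2 * i + 2 - k)" for k
  have wl: "w k \<in> D u (l k)" if "k \<le> 2 * i + 2" for k
    using that p r assms(1) by (auto simp: w_def l_def)
  have "w 0 \<noteq> w (2 * i + 2)"
  proof (rule not_closed)
    fix k assume k: "k < 2 * i + 2"
    consider "k < i" | "k = i" | "k = Suc i" | "k > Suc i" by linarith
    then show "adj (w k) (w (Suc k))"
    proof cases
      case 4
      then have "2 * i + 2 - k = Suc (2 * i + 2 - Suc k)" using k by simp
      with 4 k r(3)[of "2 * i + 2 - Suc k"] show ?thesis by (simp add: w_def adj_commute)
    qed (use p r assms(3,5) in \<open>auto simp: w_def adj_commute\<close>)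
  next
    fix k assume k: "k + 2 \<le> 2 * i + 2"
    show "w k \<noteq> w (k + 2)"
    proof (cases "k = i")
      case True
      with yz p r show ?thesis by (simp add: w_def)
    next
      case False
      then have "l k \<noteq> l (k + 2)" using k by (auto simp: l_def)
      then show ?thesis
        using wl[of k] wl[of "k + 2"] k layer_unique by (metis le_add1 le_trans)
    qed
  qed (use assms(6) in auto)
  moreover have "w 0 = u" "w (2 * i + 2) = u"
    using p(2)[of 0] r(2)[of 0] by (auto simp: w_def)
  ultimately show False by simp
qed

lemma card_back:
  assumes "x \<in> D u (Suc i)" "Suc i < d"
  shows "card {y \<in> D u i. adj x y} = 1"
proof -
  obtain y where "y \<in> D u i" "adj y x" using layer_Suc_back[OF assms(1)] .
  then have "{y \<in> D u i. adj x y} = {y}"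
    using unique_back[OF assms(1)] assms(2) adj_sym by blast
  then show ?thesis by simp
qed

lemma adj_layer:
  assumes "x \<in> D u i" "adj x y"
  shows "y \<in> D u (Suc i) \<or> y \<in> D u i \<or> (\<exists>j. i = Suc j \<and> y \<in> D u j)"
proof -
  obtain j where j: "j \<le> Suc i" "y \<in> D u j" using layer_step[OF assms] .
  obtain l where l: "l \<le> Suc j" "x \<in> D u l" using layer_step[OF j(2) adj_sym[OF assms(2)]] .
  have "l = i" using layer_unique[OF l(2) assms(1)] .
  then have "j = Suc i \<or> j = i \<or> i = Suc j" using j l by auto
  then show ?thesis using j by auto
qed

lemma degree_split:
  assumes "u \<in> V" "x \<in> D u (Suc i)"
  shows "Suc q = card {y \<in> D u i. adj x y} + card {y \<in> D u (Suc i). adj x y}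
      + card {y \<in> D u (Suc (Suc i)). adj x y}"
proof -
  have eq: "{y. adj x y} = {y \<in> D u i. adj x y} \<union> {y \<in> D u (Suc i). adj x y}
      \<union> {y \<in> D u (Suc (Suc i)). adj x y}"
    using adj_layer[OF assms(2)] by auto
  have "card {y. adj x y} = card {y \<in> D u i. adj x y} + card {y \<in> D u (Suc i). adj x y}
      + card {y \<in> D u (Suc (Suc i)). adj x y}"
    unfolding eq using finite_layer[OF assms(1)]
    by (subst card_Un_disjoint; (subst card_Un_disjoint)?)
       (auto dest: layer_unique)
  then show ?thesis using degree layer_V assms by auto
qed

lemma card_forward:
  assumes "u \<in> V" "x \<in> D u (Suc i)" "Suc i < d"
  shows "card {y \<in> D u (Suc (Suc i)). adj x y} = q"
proof -
  have "{y \<in> D u (Suc i). adj x y} = {}" using no_same_layer assms by fastforce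
  then have "card {y \<in> D u (Suc i). adj x y} = 0" by (simp only: card.empty)
  then show ?thesis using degree_split[OF assms(1,2)] card_back[OF assms(2,3)] by simp
qed

lemma sum_card_adj_swap:
  assumes "finite A" "finite B"
  shows "(\<Sum>x\<in>A. card {y \<in> B. adj x y}) = (\<Sum>y\<in>B. card {x \<in> A. adj y x})"
proof -
  have "(\<Sum>x\<in>A. card {y \<in> B. adj x y}) = (\<Sum>x\<in>A. \<Sum>y\<in>B. if adj x y then 1 else 0)"
    using assms by (simp add: sum.If_cases Int_def)
  also have "\<dots> = (\<Sum>y\<in>B. \<Sum>x\<in>A. if adj y x then 1 else 0)"
    by (subst sum.swap) (simp add: adj_commute)
  finally show ?thesis using assms by (simp add: sum.If_cases Int_def)
qed

text \<open>One edge backwards and \<open>q\<close> edges forwards at each vertex make the layers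
  grow by the factor \<open>q\<close>, as in a tree.\<close>

lemma card_layer:
  assumes "u \<in> V"
  shows "Suc i < d \<Longrightarrow> card (D u (Suc i)) = Suc q * q ^ i"
proof (induction i)
  case 0
  have "D u (Suc 0) = {y. adj u y}"
    using adj_irrefl by (auto simp: layer_def)
  then show ?case using degree assms by simp
next
  case (Suc i)
  have "card (D u (Suc (Suc i))) = (\<Sum>x\<in>D u (Suc (Suc i)). card {y \<in> D u (Suc i). adj x y})"
    using card_back Suc.prems by simp
  also have "\<dots> = (\<Sum>x\<in>D u (Suc i). card {y \<in> D u (Suc (Suc i)). adj x y})"
    using finite_layer assms by (simp add: sum_card_adj_swap)
  also have "\<dots> = card (D u (Suc i)) * q"
    using card_forward[OF assms] Suc.prems by simp
  finally show ?case using Suc by (simp add: algebra_simps)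
qed

end

section \<open>Diameter and bipartiteness\<close>

lemma mod_add_rcancel_nat: "(i + k) mod n = (j + k) mod n \<longleftrightarrow> i mod n = j mod n" for i j k n :: nat
proof -
  have "a mod n = b mod n \<longleftrightarrow> int n dvd int a - int b" for a b
    by (metis mod_eq_dvd_iff nat_int_comparison(1) zmod_int)
  then show ?thesis by simp
qed

text \<open>For \<open>m = d - 1\<close> the first two summands count a ball of radius
  \<open>d - 1\<close>; the Moore bound on the right exceeds it by
  \<open>q ^ (d - 1)\<close>.\<close>

lemma moore_sum: "1 + (\<Sum>i<m. Suc q * q ^ i) + q ^ m = 2 * (\<Sum>i<Suc m. q ^ i)" for q :: nat
  by (induction m) (auto simp: algebra_simps)

text \<open>\<open>c\<close> runs around the excess cycle with period \<open>n\<close>, so that both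
  neighbours on it can be named by \<open>Suc\<close> without subtraction. Diameter and
  bipartiteness are derived, not assumed.\<close>

locale cyclic_excess = no_short_cycles +
  fixes c :: "nat \<Rightarrow> 'a" and n :: nat
  assumes q_ge: "5 \<le> q"
    and card_V: "card V = 2 * (\<Sum>i<d. q ^ i) + 4"
    and n_def: "n = card V"
    and c_V: "range c = V"
    and c_eq: "c i = c j \<longleftrightarrow> i mod n = j mod n"
    and c_layer: "D (c (Suc i)) (Suc d) = {c i, c (Suc (Suc i))}"
begin

lemma c_in_V: "c i \<in> V"
  using c_V by blast

lemma V_c: "u \<in> V \<Longrightarrow> \<exists>i. u = c i"
  using c_V by blast

lemma n_ge: "6 \<le> n"
proof -
  have "q ^ 0 \<le> (\<Sum>i<d. q ^ i)"
    by (rule member_le_sum) (use d_pos in auto)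
  then show ?thesis using n_def card_V by simp
qed

lemma V_c_Suc:
  assumes "u \<in> V"
  obtains i where "u = c (Suc i)"
proof -
  obtain i where "u = c i" using V_c assms by blast
  moreover have "c i = c (Suc (i + n - 1))"
    using n_ge by (simp add: c_eq)
  ultimately show ?thesis using that by blast
qed

lemma c_ne: "0 < k \<Longrightarrow> k < n \<Longrightarrow> c i \<noteq> c (i + k)"
  using mod_add_rcancel_nat[of 0 i n k] by (simp add: c_eq add.commute)

lemma card_antipodal: "u \<in> V \<Longrightarrow> card (D u (Suc d)) = 2"
proof -
  assume "u \<in> V"
  then obtain i where "u = c (Suc i)" using V_c_Suc by blast
  then show ?thesis using c_layer[of i] c_ne[of 2 i] n_ge by simp
qed

text \<open>The two neighbours on a cycle determine the vertex between them unless the cycle has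
  length 4, which \<open>n_ge\<close> excludes.\<close>

lemma antipodal_inj:
  assumes "u \<in> V" "w \<in> V" "D u (Suc d) = D w (Suc d)"
  shows "u = w"
proof -
  obtain i j where ij: "u = c (Suc i)" "w = c (Suc j)"
    using V_c_Suc assms by metis
  then have "{c i, c (Suc (Suc i))} = {c j, c (Suc (Suc j))}" using assms c_layer by simp
  then consider "c i = c j" | "c i = c (j + 2)" "c (i + 2) = c j"
    by (auto simp: doubleton_eq_iff)
  then show ?thesis
  proof cases
    case 1
    then show ?thesis using mod_add_rcancel_nat[of i 1 n j] by (simp add: ij c_eq)
  next
    case 2
    then have "c (i + 2) = c (j + 2 + 2)"
      using mod_add_rcancel_nat[of i 2 n "j + 2"] by (simp only: c_eq)
    then have "c j = c (j + 4)" using 2 by (simp add: eval_nat_numeral)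
    then show ?thesis using c_ne[of 4 j] n_ge by simp
  qed
qed

lemma card_ball:
  assumes "u \<in> V"
  shows "card (\<Union>i<d. D u i) + q ^ (d - 1) + 4 = n"
proof -
  define m where "m = d - 1"
  have d: "d = Suc m" using d_pos by (simp add: m_def)
  have "card (\<Union>i<d. D u i) = (\<Sum>i<d. card (D u i))"
  proof (rule card_UN_disjoint)
    show "\<forall>i\<in>{..<d}. finite (D u i)" using finite_layer[OF assms] by blast
    show "\<forall>i\<in>{..<d}. \<forall>j\<in>{..<d}. i \<noteq> j \<longrightarrow> D u i \<inter> D u j = {}"
      by (intro ballI impI equals0I) (meson IntE layer_unique)
  qed simp
  also have "\<dots> = 1 + (\<Sum>i<m. card (D u (Suc i)))"
    unfolding d by (subst sum.lessThan_Suc_shift) simp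
  also have "\<dots> = 1 + (\<Sum>i<m. Suc q * q ^ i)"
    using card_layer assms d by simp
  finally show ?thesis using moore_sum[of q m] n_def card_V by (simp add: m_def[symmetric] d)
qed

lemma edges_to_layer_d:
  assumes "u \<in> V"
  shows "(\<Sum>x\<in>D u d. card {y \<in> D u (d - 1). adj x y}) = Suc q * q ^ (d - 1)"
proof -
  define m where "m = d - 2"
  have d: "d = Suc (Suc m)" using d_pos by (simp add: m_def)
  have "(\<Sum>x\<in>D u d. card {y \<in> D u (d - 1). adj x y}) = (\<Sum>x\<in>D u (Suc m). card {y \<in> D u d. adj x y})"
    using finite_layer assms by (simp add: sum_card_adj_swap d)
  also have "\<dots> = (\<Sum>x\<in>D u (Suc m). q)"
    using card_forward[OF assms, of _ m] by (simp add: d)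
  finally show ?thesis using card_layer[OF assms, of m] by (simp add: d algebra_simps)
qed

lemma card_adj_le: "x \<in> V \<Longrightarrow> card {y \<in> A. adj x y} \<le> Suc q"
  using degree[of x] card_mono[of "{y. adj x y}" "{y \<in> A. adj x y}"] finite_adj[of x "\<lambda>_. True"]
  by auto

text \<open>Layer \<open>d\<close> absorbs all edges going outwards from layer \<open>d - 1\<close>,
  hence has at least \<open>q ^ (d - 1)\<close> vertices. By \<open>card_ball\<close> at most two
  vertices then lie outside the layers up to \<open>d + 1\<close>, too few to give one of them
  \<open>q + 1\<close> neighbours.\<close>

lemma diameter:
  assumes "u \<in> V"
  shows "V = (\<Union>i<d. D u i) \<union> D u d \<union> D u (Suc d)" (is "V = ?U") and "card (D u d) = q ^ (d - 1) + 2"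
proof -
  have U: "?U \<subseteq> V" using layer_V assms by auto
  have fin: "finite (\<Union>i<d. D u i)" "finite (D u d)" "finite (D u (Suc d))"
    using finite_layer[OF assms] by simp_all
  have disj: "(\<Union>i<d. D u i) \<inter> D u d = {}" "((\<Union>i<d. D u i) \<union> D u d) \<inter> D u (Suc d) = {}"
    by (intro equals0I; auto dest: layer_unique)+
  have cardU: "card ?U = card (\<Union>i<d. D u i) + card (D u d) + 2"
    using fin disj card_antipodal assms by (simp add: card_Un_disjoint)
  have "Suc q * q ^ (d - 1) \<le> (\<Sum>x\<in>D u d. Suc q)"
    unfolding edges_to_layer_d[OF assms, symmetric]
    by (rule sum_mono) (use card_adj_le layer_V assms in auto)
  also have "\<dots> = Suc q * card (D u d)" by simp
  finally have low: "q ^ (d - 1) \<le> card (D u d)" by (simp only: Suc_mult_le_cancel1)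
  \<comment> \<open>\<open>R\<close> gathers the vertices farther away than \<open>d + 1\<close> and
    those that are not reachable at all.\<close>
  define R where "R = V - ?U"
  have "card V = card ?U + card R"
    unfolding R_def using U finite_V
    by (metis card_Diff_subset card_mono finite_subset le_add_diff_inverse)
  with cardU card_ball[OF assms] n_def have R: "card R + card (D u d) = q ^ (d - 1) + 2" by simp
  have "R = {}"
  proof (rule ccontr)
    assume "R \<noteq> {}"
    then obtain x where x: "x \<in> R" by blast
    have "{y. adj x y} \<subseteq> D u (Suc d) \<union> (R - {x})"
    proof
      fix y assume "y \<in> {y. adj x y}"
      then have y: "adj x y" "adj y x" "y \<in> V" using adj_sym adj_V2 by auto
      have "y \<notin> D u i" if "i \<le> d" for i
      proof
        assume "y \<in> D u i"
        then obtain j where "j \<le> Suc i" "x \<in> D u j" using layer_step[of y adj u i x] y(2) by blast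
        moreover from this(1) that consider "j < d" | "j = d" | "j = Suc d" by linarith
        ultimately show False using x unfolding R_def by cases auto
      qed
      with y adj_irrefl show "y \<in> D u (Suc d) \<union> (R - {x})"
        by (auto simp: R_def)
    qed
    then have "Suc q \<le> card (D u (Suc d) \<union> (R - {x}))"
      using degree[of x] x finite_V fin by (metis DiffD1 R_def card_mono finite_Diff finite_UnI)
    also have "\<dots> \<le> 2 + (card R - 1)"
      using card_Un_le[of "D u (Suc d)" "R - {x}"] card_antipodal assms x by (simp add: R_def finite_V)
    finally show False using R low q_ge by simp
  qed
  then show "V = ?U" using U R_def by blast
  show "card (D u d) = q ^ (d - 1) + 2" using R \<open>R = {}\<close> by simp
qed

section \<open>Distances, and the arcs that obstruct a colouring by parity\<close>

definition dst :: "'a \<Rightarrow> 'a \<Rightarrow> nat" where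
  "dst u w = (THE i. w \<in> D u i)"

lemma dst_eqI: "w \<in> D u i \<Longrightarrow> dst u w = i"
  unfolding dst_def by (rule the_equality) (assumption, erule (1) layer_unique)

lemma layer_exists:
  assumes "u \<in> V" "w \<in> V"
  obtains i where "i \<le> Suc d" "w \<in> D u i"
proof -
  have "w \<in> (\<Union>i<d. D u i) \<union> D u d \<union> D u (Suc d)"
    using diameter(1)[OF assms(1)] assms(2) by blast
  then consider i where "i < d" "w \<in> D u i" | "w \<in> D u d" | "w \<in> D u (Suc d)" by blast
  then show thesis
  proof cases
    case (1 i)
    with that[of i] show ?thesis by simp
  qed (use that[of d] that[of "Suc d"] in simp_all)
qed

lemma layer_dst: "u \<in> V \<Longrightarrow> w \<in> V \<Longrightarrow> w \<in> D u (dst u w)"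
  using layer_exists dst_eqI by metis

lemma layer_iff_dst: "u \<in> V \<Longrightarrow> w \<in> V \<Longrightarrow> w \<in> D u i \<longleftrightarrow> dst u w = i"
  using layer_dst dst_eqI by blast

lemma dst_le: "u \<in> V \<Longrightarrow> w \<in> V \<Longrightarrow> dst u w \<le> Suc d"
  using layer_exists dst_eqI by metis

lemma dst_commute: "u \<in> V \<Longrightarrow> w \<in> V \<Longrightarrow> dst u w = dst w u"
  using layer_dst[of u w] layer_sym[of w u "dst u w"] dst_eqI[of u w "dst u w"] by simp

lemma dst_adj:
  assumes "u \<in> V" "adj x y"
  shows "dst u y \<le> Suc (dst u x)"
proof -
  have "x \<in> D u (dst u x)" using layer_dst assms adj_V by blast
  then obtain j where "j \<le> Suc (dst u x)" "y \<in> D u j" using assms(2) by (rule layer_step)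
  then show ?thesis using dst_eqI by blast
qed

lemma dst_0_iff: "u \<in> V \<Longrightarrow> w \<in> V \<Longrightarrow> dst u w = 0 \<longleftrightarrow> u = w"
  using layer_iff_dst[of u w 0] by auto

text \<open>These are the arcs violating the colouring by parity of the distance from
  \<open>u\<close>; each edge counts as two arcs.\<close>

definition bad :: "'a \<Rightarrow> ('a \<times> 'a) set" where
  "bad u = {(x, y). adj x y \<and> dst u x = dst u y}"

definition antipodal_arcs :: "'a \<Rightarrow> ('a \<times> 'a) set" where
  "antipodal_arcs u = {(x, y). x \<in> D u (Suc d) \<and> y \<in> D u (Suc d) \<and> adj x y}"

lemma finite_bad: "finite (bad u)"
  by (rule finite_subset[of _ "V \<times> V"]) (auto simp: bad_def finite_V dest: adj_V adj_V2)

lemma antipodal_arcs_bad: "u \<in> V \<Longrightarrow> antipodal_arcs u \<subseteq> bad u"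
  using dst_eqI[of _ u "Suc d"] by (auto simp: antipodal_arcs_def bad_def)

lemma card_pairs: "finite A \<Longrightarrow> card {(x, y). x \<in> A \<and> y \<in> A \<and> adj x y} = (\<Sum>x\<in>A. card {y \<in> A. adj x y})"
proof -
  assume "finite A"
  have "{(x, y). x \<in> A \<and> y \<in> A \<and> adj x y} = Sigma A (\<lambda>x. {y \<in> A. adj x y})" by auto
  then show ?thesis using \<open>finite A\<close> by simp
qed

text \<open>Summing degrees over layer \<open>d\<close>, minus the edges back to layer
  \<open>d - 1\<close>, gives \<open>2 * Suc q\<close>, and so does summing over layer
  \<open>d + 1\<close>. The edges between these two layers enter both sums equally.\<close>

lemma same_layer_counts:
  assumes "u \<in> V"
  shows "(\<Sum>x\<in>D u d. card {y \<in> D u d. adj x y}) = (\<Sum>x\<in>D u (Suc d). card {y \<in> D u (Suc d). adj x y})"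
    (is "?S = ?S'")
proof -
  define m where "m = d - 1"
  have d: "d = Suc m" using d_pos by (simp add: m_def)
  let ?e = "\<Sum>x\<in>D u d. card {y \<in> D u (Suc d). adj x y}"
  have "(\<Sum>x\<in>D u d. Suc q) = (\<Sum>x\<in>D u d. card {y \<in> D u m. adj x y}
      + card {y \<in> D u d. adj x y} + card {y \<in> D u (Suc d). adj x y})"
    by (intro sum.cong refl degree_split[OF assms, of _ m, folded d])
  then have "Suc q * card (D u d) = (\<Sum>x\<in>D u d. card {y \<in> D u m. adj x y}) + ?S + ?e"
    by (simp only: sum.distrib sum_constant of_nat_id mult.commute)
  then have 1: "2 * Suc q = ?S + ?e"
    unfolding edges_to_layer_d[OF assms, folded m_def] diameter(2)[OF assms]
    by (simp add: algebra_simps m_def)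
  have "w \<notin> D u (Suc (Suc d))" for w
    using dst_eqI[of w u "Suc (Suc d)"] dst_le[OF assms, of w] layer_V[OF assms, of w "Suc (Suc d)"]
    by linarith
  then have empty: "D u (Suc (Suc d)) = {}" by blast
  have "(\<Sum>x\<in>D u (Suc d). Suc q) = (\<Sum>x\<in>D u (Suc d). card {y \<in> D u d. adj x y}
      + card {y \<in> D u (Suc d). adj x y} + card {y \<in> D u (Suc (Suc d)). adj x y})"
    by (rule sum.cong[OF refl]) (rule degree_split[OF assms])
  then have "2 * Suc q = (\<Sum>x\<in>D u (Suc d). card {y \<in> D u d. adj x y}) + ?S'"
    unfolding empty using card_antipodal[OF assms] by (simp add: sum.distrib)
  then show ?thesis
    using 1 sum_card_adj_swap[of "D u (Suc d)" "D u d"] finite_layer[OF assms] by simp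
qed

text \<open>By \<open>no_same_layer\<close> only the layers \<open>d\<close> and
  \<open>d + 1\<close> contain bad arcs, and they contain equally many.\<close>

lemma card_bad:
  assumes "u \<in> V"
  shows "card (bad u) = 2 * card (antipodal_arcs u)"
proof -
  let ?P = "\<lambda>i. {(x, y). x \<in> D u i \<and> y \<in> D u i \<and> adj x y}"
  have "bad u = ?P d \<union> ?P (Suc d)"
  proof (intro equalityI subsetI)
    fix z assume "z \<in> bad u"
    then obtain x y where z: "z = (x, y)" "adj x y" "dst u x = dst u y" "x \<in> V" "y \<in> V"
      by (auto simp: bad_def dest: adj_V adj_V2)
    then have l: "x \<in> D u (dst u x)" "y \<in> D u (dst u x)" using layer_dst assms by metis+
    then have "d \<le> dst u x" using no_same_layer z by blast
    then have "dst u x = d \<or> dst u x = Suc d" using dst_le[of u x] assms z by linarith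
    then show "z \<in> ?P d \<union> ?P (Suc d)"
      using z l by auto
  qed (use dst_eqI[of _ u d] dst_eqI[of _ u "Suc d"] in \<open>auto simp: bad_def\<close>)
  moreover have "?P d \<inter> ?P (Suc d) = {}" by (auto dest: layer_unique)
  moreover have "finite (?P i)" for i
    by (rule finite_subset[of _ "V \<times> V"]) (auto simp: finite_V dest: adj_V adj_V2)
  ultimately have "card (bad u) = card (?P d) + card (?P (Suc d))"
    by (simp add: card_Un_disjoint)
  then show ?thesis
    using same_layer_counts[OF assms] finite_layer[OF assms] card_pairs antipodal_arcs_def by simp
qed

lemma good_edge_parity:
  assumes "adj x y" "\<And>u. u \<in> V \<Longrightarrow> (x, y) \<notin> bad u"
  shows "u \<in> V \<Longrightarrow> even (dst x u) \<longleftrightarrow> odd (dst y u)"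
proof -
  assume u: "u \<in> V"
  have xy: "x \<in> V" "y \<in> V" using assms adj_V adj_V2 by auto
  have "dst u x \<noteq> dst u y" using assms u by (auto simp: bad_def)
  moreover have "dst u x \<le> Suc (dst u y)" "dst u y \<le> Suc (dst u x)"
    using dst_adj u assms(1) adj_sym by blast+
  ultimately have "dst u x = Suc (dst u y) \<or> dst u y = Suc (dst u x)" by linarith
  then have "even (dst u x) \<longleftrightarrow> odd (dst u y)" by auto
  then show ?thesis using dst_commute u xy by metis
qed

text \<open>Distances from \<open>u\<close> to adjacent vertices differ by at most one, so they
  agree as soon as their parities do.\<close>

lemma bad_iff_parity:
  assumes "u \<in> V" "adj x y"
  shows "(x, y) \<in> bad u \<longleftrightarrow> (even (dst u x) \<longleftrightarrow> even (dst u y))"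
proof -
  have "dst u x \<le> Suc (dst u y)" "dst u y \<le> Suc (dst u x)"
    using dst_adj assms adj_sym by blast+
  then have "dst u x = dst u y \<or> dst u x = Suc (dst u y) \<or> dst u y = Suc (dst u x)" by linarith
  then show ?thesis using assms by (auto simp: bad_def)
qed

text \<open>Passing from \<open>x\<close> to \<open>y\<close> flips the parity of the distance to
  every vertex, so the two ends of an arc agree in parity for \<open>x\<close> if and only if they
  do for \<open>y\<close>.\<close>

lemma good_edge_bad_eq:
  assumes "adj x y" "\<And>u. u \<in> V \<Longrightarrow> (x, y) \<notin> bad u"
  shows "bad x = bad y"
proof -
  have "x \<in> V" "y \<in> V" using assms adj_V adj_V2 by auto
  have "(a, b) \<in> bad x \<longleftrightarrow> (a, b) \<in> bad y" if "adj a b" for a b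
  proof -
    have "a \<in> V" "b \<in> V" using that adj_V adj_V2 by auto
    then show ?thesis
      using bad_iff_parity[OF \<open>x \<in> V\<close> that] bad_iff_parity[OF \<open>y \<in> V\<close> that]
        good_edge_parity[OF assms] by metis
  qed
  then show ?thesis by (auto simp: bad_def)
qed

lemma antipodal_arcs_cases:
  assumes "u \<in> V"
  obtains "antipodal_arcs u = {}" | "card (antipodal_arcs u) = 2"
proof -
  obtain a b where ab: "D u (Suc d) = {a, b}" "a \<noteq> b"
    using card_antipodal[OF assms] by (metis card_2_iff)
  show thesis
  proof (cases "adj a b")
    case True
    then have "antipodal_arcs u = {(a, b), (b, a)}"
      using adj_irrefl adj_sym by (auto simp: antipodal_arcs_def ab)
    then show ?thesis using that ab by simp
  next
    case False
    then have "antipodal_arcs u = {}"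
      using adj_irrefl adj_sym by (auto simp: antipodal_arcs_def ab)
    then show ?thesis using that by simp
  qed
qed

text \<open>The ends of such an arc are all the antipodes of \<open>u\<close>, and these determine
  \<open>u\<close> by \<open>antipodal_inj\<close>.\<close>

lemma antipodal_arcs_disjoint:
  assumes "u \<in> V" "w \<in> V" "u \<noteq> w"
  shows "antipodal_arcs u \<inter> antipodal_arcs w = {}"
proof -
  have "D u (Suc d) = {a, b}" if "(a, b) \<in> antipodal_arcs u" "u \<in> V" for a b u
  proof -
    have "{a, b} \<subseteq> D u (Suc d)" "a \<noteq> b" using that adj_irrefl by (auto simp: antipodal_arcs_def)
    then show ?thesis
      using card_antipodal[OF that(2)] card_subset_eq[OF finite_layer[OF that(2)], of "{a, b}" "Suc d"]
      by simp
  qed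
  then show ?thesis using antipodal_inj assms by (metis disjoint_iff surj_pair)
qed

text \<open>If no vertex were free of bad arcs, every vertex would have exactly four. Since the degree is
  at least six, averaging yields a vertex with two neighbours reached by edges that are never bad;
  these three vertices share their four bad arcs, although their antipodal arcs are disjoint.\<close>

lemma exists_no_bad: "\<exists>u\<in>V. bad u = {}"
proof (rule ccontr)
  assume ne: "\<not> ?thesis"
  have arcs2: "card (antipodal_arcs u) = 2" if "u \<in> V" for u
    using antipodal_arcs_cases[OF that] card_bad[OF that] ne finite_bad[of u] that
    by (metis card.empty card_0_eq mult_0_right)
  then have bad4: "card (bad u) = 4" if "u \<in> V" for u
    using card_bad that by simp
  define N where "N x = {y. adj x y \<and> (\<exists>u\<in>V. (x, y) \<in> bad u)}" for x
  have "(\<Sum>x\<in>V. card (N x)) \<le> (\<Sum>x\<in>V. card {p \<in> V \<times> V. (x, snd p) \<in> bad (fst p)})"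
  proof (rule sum_mono)
    fix x
    have "N x \<subseteq> snd ` {p \<in> V \<times> V. (x, snd p) \<in> bad (fst p)}"
      using adj_V2 by (fastforce simp: N_def image_iff)
    then show "card (N x) \<le> card {p \<in> V \<times> V. (x, snd p) \<in> bad (fst p)}"
      by (rule surj_card_le[rotated]) (rule finite_subset[of _ "V \<times> V"], auto simp: finite_V)
  qed
  also have "\<dots> = card (Sigma V (\<lambda>x. {p \<in> V \<times> V. (x, snd p) \<in> bad (fst p)}))"
    using finite_V by simp
  also have "\<dots> = card (Sigma V bad)"
    by (rule bij_betw_same_card[of "\<lambda>(x, u, y). (u, x, y)"])
       (rule bij_betw_byWitness[where f' = "\<lambda>(u, x, y). (x, u, y)"];
        auto simp: bad_def dest: adj_V adj_V2)
  also have "\<dots> = 4 * card V" using finite_V finite_bad bad4 by simp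
  finally have "(\<Sum>x\<in>V. card (N x)) \<le> 4 * card V" .
  moreover have "(\<Sum>x\<in>V. card (N x)) \<ge> 5 * card V" if "\<forall>x\<in>V. card (N x) \<ge> 5"
    using sum_bounded_below[of V 5 "\<lambda>x. card (N x)"] that by (simp add: mult.commute)
  moreover have "card V > 0" using n_ge n_def by simp
  ultimately obtain x where x: "x \<in> V" "card (N x) \<le> 4" by fastforce
  have "card ({y. adj x y} - N x) = Suc q - card (N x)"
    using degree[OF x(1)] finite_adj[of x "\<lambda>_. True"] 
    by (subst card_Diff_subset) (auto simp: N_def finite_adj)
  then have "2 \<le> card ({y. adj x y} - N x)" using x q_ge by simp
  then obtain y z where yz: "y \<noteq> z" "adj x y" "y \<notin> N x" "adj x z" "z \<notin> N x"
    by (metis (no_types, lifting) Diff_iff card_le_Suc0_iff_eq[of "{y. adj x y} - N x"]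
      card.infinite mem_Collect_eq not_less_eq_eq numeral_2_eq_2 zero_le)
  have V: "y \<in> V" "z \<in> V" "x \<noteq> y" "x \<noteq> z" using yz adj_V2 adj_irrefl by auto
  have eq: "bad x = bad y" "bad x = bad z"
    by (rule good_edge_bad_eq; use yz in \<open>auto simp: N_def\<close>)+
  let ?Q = antipodal_arcs
  have "?Q x \<union> ?Q y \<union> ?Q z \<subseteq> bad x"
    using antipodal_arcs_bad V x eq by blast
  then have "card (?Q x \<union> ?Q y \<union> ?Q z) \<le> 4"
    using bad4 x finite_bad card_mono by metis
  moreover have fin: "finite (?Q w)" if "w \<in> V" for w
    using arcs2[OF that] card.infinite by fastforce
  have "card (?Q x \<union> ?Q y \<union> ?Q z) = 6"
    using V x yz fin arcs2 antipodal_arcs_disjoint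
    by (simp add: card_Un_disjoint Int_Un_distrib2)
  ultimately show False by simp
qed

lemma bipartite: "\<exists>s :: 'a \<Rightarrow> bool. \<forall>x y. adj x y \<longrightarrow> s x \<noteq> s y"
proof -
  obtain u where u: "u \<in> V" "bad u = {}" using exists_no_bad by blast
  show ?thesis
    by (rule exI[of _ "\<lambda>x. even (dst u x)"]) (use bad_iff_parity u in auto)
qed

end

section \<open>Integral two by two matrices\<close>

text \<open>For a two by two matrix \<open>C\<close> of trace \<open>t\<close> and determinant \<open>D\<close>, Cayley-Hamilton reduces the
  polynomial \<open>p_i\<close> with \<open>p_0 = 1\<close>, \<open>p_1 = x\<close>, \<open>p_(i+2) = x p_(i+1) - q p_i\<close> to \<open>p_i(C) = a C + b\<close>;
  the pair \<open>(a, b)\<close> is computed here.\<close>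

fun cheb :: "int \<Rightarrow> int \<Rightarrow> int \<Rightarrow> nat \<Rightarrow> int \<times> int" where
  "cheb t D q 0 = (0, 1)"
| "cheb t D q (Suc 0) = (1, 0)"
| "cheb t D q (Suc (Suc i)) =
    (t * fst (cheb t D q (Suc i)) + snd (cheb t D q (Suc i)) - q * fst (cheb t D q i),
     - D * fst (cheb t D q (Suc i)) - q * snd (cheb t D q i))"

lemma cheb_mod_cong:
  assumes "t mod m = t' mod m" "D mod m = D' mod m" "q mod m = q' mod m"
  shows "fst (cheb t D q i) mod m = fst (cheb t' D' q' i) mod m \<and>
    snd (cheb t D q i) mod m = snd (cheb t' D' q' i) mod m"
  using assms
proof (induction t D q i rule: cheb.induct)
  case (3 t D q i)
  then show ?case
    unfolding cheb.simps fst_conv snd_conv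
    by (intro conjI mod_diff_cong mod_add_cong mod_mult_cong mod_minus_cong) auto
qed auto

text \<open>Modulo 3 the polynomial \<open>p_i\<close> becomes \<open>x ^ i\<close>, so
  \<open>x ^ 2 - t * x + D\<close> would divide \<open>x ^ i - 1\<close> over the field of three
  elements. For \<open>i = 5\<close> and \<open>i = 7\<close> there is no quadratic factor; the
  proof checks the nine residue pairs.\<close>

lemma cheb_mod_3:
  assumes "q mod 3 = 0" "i = 5 \<or> i = 7" "fst (cheb t D q i) = 0" "snd (cheb t D q i) = 1"
  shows False
proof -
  have c: "fst (cheb (t mod 3) (D mod 3) 0 i) mod 3 = 0 \<and> snd (cheb (t mod 3) (D mod 3) 0 i) mod 3 = 1"
    using cheb_mod_cong[of t 3 "t mod 3" D "D mod 3" q 0 i] assms by simp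
  have "t mod 3 = 0 \<or> t mod 3 = 1 \<or> t mod 3 = 2" "D mod 3 = 0 \<or> D mod 3 = 1 \<or> D mod 3 = 2"
    by presburger+
  then show False
    using c assms(2) by (elim disjE) (simp_all add: eval_nat_numeral)
qed

text \<open>\<open>x + x\<close> and \<open>x * x\<close> are trace and determinant of the scalar
  matrix \<open>x\<close>, so the left sides are the values \<open>p_i(x)\<close>.\<close>

lemma cheb_scalar:
  "fst (cheb (x + x) (x * x) q 3) * x + snd (cheb (x + x) (x * x) q 3) = x ^ 3 - 2 * q * x"
  "fst (cheb (x + x) (x * x) q 5) * x + snd (cheb (x + x) (x * x) q 5) =
    x ^ 5 - 4 * q * x ^ 3 + 3 * q ^ 2 * x"
  "fst (cheb (x + x) (x * x) q 7) * x + snd (cheb (x + x) (x * x) q 7) =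
    x ^ 7 - 6 * q * x ^ 5 + 10 * q ^ 2 * x ^ 3 - 4 * q ^ 3 * x"
  by (simp_all add: eval_nat_numeral algebra_simps)

text \<open>For odd \<open>i\<close> every term of \<open>p_i\<close> contains \<open>x\<close>, so
  \<open>p_i(x) = 1\<close> leaves only \<open>x = 1\<close> and \<open>x = -1\<close>, for which
  \<open>q\<close> is too large.\<close>

lemma cheb_scalar_ne_1:
  assumes "5 \<le> q" "i = 3 \<or> i = 5 \<or> i = 7"
  shows "fst (cheb (x + x) (x * x) q i) * x + snd (cheb (x + x) (x * x) q i) \<noteq> 1"
proof
  assume eq: "fst (cheb (x + x) (x * x) q i) * x + snd (cheb (x + x) (x * x) q i) = 1"
  have "x dvd fst (cheb (x + x) (x * x) q i) * x + snd (cheb (x + x) (x * x) q i)"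
    using assms(2)
    by (elim disjE; hypsubst; simp only: cheb_scalar) (auto intro!: dvd_diff dvd_add)
  then have "x dvd 1" unfolding eq .
  then have x: "x = 1 \<or> x = -1" by (simp add: abs_if split: if_splits)
  \<comment> \<open>These bounds allow linear arithmetic to treat the powers of \<open>q\<close> as
    unknowns.\<close>
  have q2: "5 * q \<le> q ^ 2" using assms(1) by (simp add: power2_eq_square)
  have q3: "5 * q ^ 2 \<le> q ^ 3" using assms(1) by (simp add: power2_eq_square power3_eq_cube)
  have "x ^ 3 - 2 * q * x = 1 \<or> x ^ 5 - 4 * q * x ^ 3 + 3 * q ^ 2 * x = 1 \<or>
      x ^ 7 - 6 * q * x ^ 5 + 10 * q ^ 2 * x ^ 3 - 4 * q ^ 3 * x = 1"
    using assms(2) eq by (elim disjE; hypsubst) (simp_all only: cheb_scalar simp_thms)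
  then show False using x assms(1) q2 q3 by (elim disjE) simp_all
qed

text \<open>The matrix \<open>C\<close> with diagonal \<alpha>, \<epsilon> and other entries
  \<beta>, \<gamma> satisfies \<open>a C + b = 1\<close>. If \<open>a\<close> is nonzero,
  \<open>C\<close> is scalar. Otherwise \<open>b = 1\<close>, which is refuted directly for
  \<open>i = 3\<close> and modulo 3 for the other \<open>i\<close>.\<close>

lemma cheb_matrix_ne_1:
  assumes "5 \<le> q" "i = 3 \<or> (q mod 3 = 0 \<and> (i = 5 \<or> i = 7))"
    and "fst (cheb (\<alpha> + \<epsilon>) (\<alpha> * \<epsilon> - \<beta> * \<gamma>) q i) = a" "snd (cheb (\<alpha> + \<epsilon>) (\<alpha> * \<epsilon> - \<beta> * \<gamma>) q i) = b"
    and "a * \<alpha> + b = 1" "a * \<beta> = 0" "a * \<gamma> = 0" "a * \<epsilon> + b = 1"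
  shows False
proof (cases "a = 0")
  case True
  then have b: "b = 1" using assms by simp
  show False
  proof (cases "i = 3")
    case i3: True
    let ?t = "\<alpha> + \<epsilon>" and ?D = "\<alpha> * \<epsilon> - \<beta> * \<gamma>"
    have 1: "?t * ?t - ?D - 2 * q = 0" using assms(3) True i3
      by (simp add: eval_nat_numeral)
    \<comment> \<open>The constant coefficient being 1 makes the trace a unit.\<close>
    have 2: "- ?D * ?t = 1" using assms(4) b i3 by (simp add: eval_nat_numeral)
    then have "?t dvd 1" by (metis dvd_triv_right)
    then have "?t = 1 \<or> ?t = -1" by (simp add: abs_if split: if_splits)
    then show False using 1 2 assms(1) by (elim disjE) simp_all
  next
    case False
    with assms True b show False
      using cheb_mod_3[of q i "\<alpha> + \<epsilon>" "\<alpha> * \<epsilon> - \<beta> * \<gamma>"] by auto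
  qed
next
  case False
  then have "\<beta> = 0" "\<gamma> = 0" using assms by auto
  moreover have "a * \<alpha> = a * \<epsilon>" using assms(5,8) by linarith
  then have "\<alpha> = \<epsilon>" using False by simp
  ultimately show False
    using cheb_scalar_ne_1[of q i \<epsilon>] assms by auto
qed

section \<open>The eigenspace of the excess cycle\<close>

context cyclic_excess
begin

definition side :: "'a \<Rightarrow> bool" where
  "side = (SOME s. \<forall>x y. adj x y \<longrightarrow> s x \<noteq> s y)"

lemma side_adj: "adj x y \<Longrightarrow> side y \<longleftrightarrow> \<not> side x"
  using someI_ex[OF bipartite] unfolding side_def by blast

lemma side_layer: "w \<in> D u i \<Longrightarrow> even i \<longleftrightarrow> side u = side w"
proof (induction i arbitrary: w)
  case (Suc i)
  obtain y where "y \<in> D u i" "adj y w" using layer_Suc_back[OF Suc.prems] .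
  with Suc.IH[of y] side_adj[of y w] show ?case by auto
qed simp

lemma side_dst: "u \<in> V \<Longrightarrow> w \<in> V \<Longrightarrow> even (dst u w) \<longleftrightarrow> side u = side w"
  using side_layer[OF layer_dst] .

definition A :: "('a \<Rightarrow> int) \<Rightarrow> 'a \<Rightarrow> int" where
  "A f u = (\<Sum>v | adj u v. f v)"

definition E :: "('a \<Rightarrow> int) \<Rightarrow> 'a \<Rightarrow> int" where
  "E f u = (\<Sum>v\<in>D u (Suc d). f v)"

text \<open>On the bipartite graph, \<open>P i\<close> is the polynomial \<open>p_i\<close> in \<open>A\<close> with \<open>p_0 = 1\<close>, \<open>p_1 = x\<close> and
  \<open>p_(i+2) = x p_(i+1) - q p_i\<close>, as long as \<open>i < d\<close>.\<close>

definition P :: "nat \<Rightarrow> ('a \<Rightarrow> int) \<Rightarrow> 'a \<Rightarrow> int" where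
  "P i f u = (\<Sum>w\<in>V. if dst u w \<le> i \<and> even (dst u w + i) then f w else 0)"

definition half_sum :: "('a \<Rightarrow> int) \<Rightarrow> bool \<Rightarrow> int" where
  "half_sum f b = (\<Sum>w | w \<in> V \<and> side w = b. f w)"

lemma A_cong: "(\<And>v. v \<in> V \<Longrightarrow> f v = g v) \<Longrightarrow> A f u = A g u"
  unfolding A_def by (rule sum.cong) (auto dest: adj_V2)

lemma A_linear: "A (\<lambda>v. x * f v + y * g v) u = x * A f u + y * A g u"
  by (simp add: A_def sum.distrib sum_distrib_left)

section \<open>The operators \<open>P i\<close> as polynomials in \<open>A\<close>\<close>

lemma P_0:
  assumes "u \<in> V"
  shows "P 0 f u = f u"
proof -
  have "P 0 f u = (\<Sum>w\<in>V. if w = u then f w else 0)"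
    unfolding P_def by (rule sum.cong) (use dst_0_iff[OF assms] dst_0_iff[OF assms assms] in auto)
  then show ?thesis using assms finite_V by simp
qed

lemma layer_1: "D u (Suc 0) = {y. adj u y}"
  using adj_irrefl by (auto simp: layer_def)

lemma P_1:
  assumes "u \<in> V"
  shows "P (Suc 0) f u = A f u"
proof -
  have "P (Suc 0) f u = (\<Sum>w\<in>V. if adj u w then f w else 0)"
    unfolding P_def
  proof (rule sum.cong[OF refl])
    fix w assume "w \<in> V"
    then have "dst u w = Suc 0 \<longleftrightarrow> adj u w"
      using layer_iff_dst[OF assms, of w "Suc 0"] layer_1 by auto
    moreover have "dst u w \<le> Suc 0 \<and> even (dst u w + Suc 0) \<longleftrightarrow> dst u w = Suc 0"
      by (auto simp: le_Suc_eq)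
    ultimately show "(if dst u w \<le> Suc 0 \<and> even (dst u w + Suc 0) then f w else 0) =
        (if adj u w then f w else 0)" by simp
  qed
  also have "\<dots> = A f u"
    unfolding A_def using finite_V by (subst sum.inter_filter[symmetric]) (auto intro!: sum.cong dest: adj_V2)
  finally show ?thesis .
qed

text \<open>This is the coefficient of \<open>f w\<close> in \<open>A (P (Suc j) f) u\<close>. At
  the right parity, a vertex \<open>w\<close> within distance \<open>j\<close> of \<open>u\<close>
  is counted by all \<open>q + 1\<close> neighbours of \<open>u\<close>, one at distance
  \<open>j + 2\<close> only by the unique neighbour of \<open>u\<close> closer to it.\<close>

lemma card_neighbours_towards:
  assumes "u \<in> V" "w \<in> V" "Suc (Suc j) < d"
  shows "int (card {v. adj u v \<and> dst v w \<le> Suc j \<and> even (dst v w + Suc j)}) =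
    (if dst u w \<le> Suc (Suc j) \<and> even (dst u w + Suc (Suc j)) then 1 else 0) +
    int q * (if dst u w \<le> j \<and> even (dst u w + j) then 1 else 0)"
    (is "int (card ?N) = _")
proof -
  have nb: "dst v w \<le> Suc (dst u w)" "dst u w \<le> Suc (dst v w)" "odd (dst u w + dst v w)"
    if "adj u v" for v
  proof -
    have v: "v \<in> V" using that adj_V2 by blast
    show "dst v w \<le> Suc (dst u w)" "dst u w \<le> Suc (dst v w)"
      using dst_adj[OF assms(2) that] dst_adj[OF assms(2) adj_sym[OF that]] dst_commute assms v
      by simp_all
    show "odd (dst u w + dst v w)"
      using side_dst[of u w] side_dst[of v w] side_adj[OF that] assms v by auto
  qed
  have "dst u w \<le> j \<or> dst u w = Suc j \<or> dst u w = Suc (Suc j) \<or> dst u w > Suc (Suc j)"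
    by linarith
  then consider "odd (dst u w + j)" | "even (dst u w + j)" "dst u w \<le> j"
    | "dst u w = Suc (Suc j)" | "even (dst u w + j)" "dst u w > Suc (Suc j)"
    by (cases "even (dst u w + j)") auto
  then show ?thesis
  proof cases
    case 1
    then have N: "?N = {}" using nb by fastforce
    show ?thesis unfolding N using 1 by simp
  next
    case 2
    have N: "?N = {v. adj u v}"
    proof (intro Collect_cong iffI conjI)
      fix v assume "adj u v"
      from nb[OF this] 2 show "dst v w \<le> Suc j" "even (dst v w + Suc j)" by auto
    qed auto
    show ?thesis unfolding N using 2 degree[OF assms(1)] by simp
  next
    case 3
    have N: "?N = {v \<in> D w (Suc j). adj u v}"
    proof (rule Collect_cong)
      fix v
      have "v \<in> D w (Suc j) \<longleftrightarrow> dst v w \<le> Suc j \<and> even (dst v w + Suc j)" if "adj u v"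
      proof -
        have "v \<in> V" using that adj_V2 by blast
        then have "v \<in> D w (Suc j) \<longleftrightarrow> dst v w = Suc j"
          using layer_iff_dst[of w v "Suc j"] dst_commute[of w v] assms by simp
        then show ?thesis using nb[OF that] 3 by auto
      qed
      then show "adj u v \<and> dst v w \<le> Suc j \<and> even (dst v w + Suc j) \<longleftrightarrow> v \<in> D w (Suc j) \<and> adj u v"
        by blast
    qed
    have "u \<in> D w (Suc (Suc j))"
      using 3 layer_iff_dst[of w u] dst_commute[of w u] assms by simp
    then have "card {v \<in> D w (Suc j). adj u v} = 1" using card_back assms(3) by blast
    then show ?thesis unfolding N using 3 by simp
  next
    case 4
    then have N: "?N = {}" using nb by fastforce
    show ?thesis unfolding N using 4 by simp
  qed
qed

lemma P_Suc_Suc: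
  assumes "u \<in> V" "Suc (Suc j) < d"
  shows "P (Suc (Suc j)) f u = A (P (Suc j) f) u - int q * P j f u"
proof -
  let ?c = "\<lambda>i v w. dst v w \<le> i \<and> even (dst v w + i)"
  have "A (P (Suc j) f) u = (\<Sum>w\<in>V. \<Sum>v | adj u v. if ?c (Suc j) v w then f w else 0)"
    unfolding A_def P_def by (rule sum.swap)
  also have "\<dots> = (\<Sum>w\<in>V. (if ?c (Suc (Suc j)) u w then f w else 0) +
      int q * (if ?c j u w then f w else 0))"
  proof (rule sum.cong[OF refl])
    fix w assume w: "w \<in> V"
    have "(\<Sum>v | adj u v. if ?c (Suc j) v w then f w else 0) =
        (\<Sum>v | adj u v \<and> ?c (Suc j) v w. f w)"
      using finite_adj[of u "\<lambda>_. True"] by (simp add: sum.If_cases Int_def)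
    also have "\<dots> = int (card {v. adj u v \<and> ?c (Suc j) v w}) * f w" by simp
    also have "\<dots> = (if ?c (Suc (Suc j)) u w then f w else 0) +
      int q * (if ?c j u w then f w else 0)"
      unfolding card_neighbours_towards[OF assms(1) w assms(2)] by (simp add: distrib_right)
    finally show "(\<Sum>v | adj u v. if ?c (Suc j) v w then f w else 0) =
      (if ?c (Suc (Suc j)) u w then f w else 0) + int q * (if ?c j u w then f w else 0)" .
  qed
  also have "\<dots> = P (Suc (Suc j)) f u + int q * P j f u"
    unfolding P_def by (simp only: sum.distrib sum_distrib_left)
  finally show ?thesis by simp
qed

lemma P_A_commute:
  assumes "i < d" "u \<in> V"
  shows "P i (A f) u = A (P i f) u"
  using assms
proof (induction i arbitrary: u rule: induct_nat_012)
  case 0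
  then show ?case using P_0 A_cong[of "P 0 f" f u] by simp
next
  case 1
  then show ?case using P_1 A_cong[of "P (Suc 0) f" "A f" u] by simp
next
  case (ge2 i)
  have "P (Suc (Suc i)) (A f) u = A (P (Suc i) (A f)) u - int q * P i (A f) u"
    using P_Suc_Suc ge2.prems by blast
  \<comment> \<open>The factor 1 produces the shape of \<open>A_linear\<close>, which is applied
    from right to left next.\<close>
  also have "\<dots> = 1 * A (A (P (Suc i) f)) u + (- int q) * A (P i f) u"
    using ge2 A_cong[of "P (Suc i) (A f)" "A (P (Suc i) f)" u] by simp
  also have "\<dots> = A (P (Suc (Suc i)) f) u"
    unfolding A_linear[symmetric] by (rule A_cong) (use P_Suc_Suc ge2.prems in simp)
  finally show ?case .
qed

text \<open>Each \<open>f w\<close> on the other side is counted \<open>m\<close> times. The general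
  neighbourhood \<open>N\<close> serves both \<open>A\<close> and \<open>E\<close>.\<close>

lemma half_sum_swap:
  assumes "\<And>u. u \<in> V \<Longrightarrow> N u \<subseteq> V" "\<And>u. u \<in> V \<Longrightarrow> card (N u) = m"
    and "\<And>u w. u \<in> V \<Longrightarrow> w \<in> N u \<Longrightarrow> u \<in> N w \<and> side w \<noteq> side u"
  shows "half_sum (\<lambda>u. \<Sum>w\<in>N u. f w) b = int m * half_sum f (\<not> b)"
proof -
  let ?H = "{w \<in> V. side w = b}" and ?K = "{w \<in> V. side w = (\<not> b)}"
  have "half_sum (\<lambda>u. \<Sum>w\<in>N u. f w) b = (\<Sum>u\<in>?H. \<Sum>w\<in>?K. if w \<in> N u then f w else 0)"
    unfolding half_sum_def
  proof (rule sum.cong[OF refl])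
    fix u assume u: "u \<in> ?H"
    then have "N u = {w \<in> ?K. w \<in> N u}" using assms by blast
    then show "(\<Sum>w\<in>N u. f w) = (\<Sum>w\<in>?K. if w \<in> N u then f w else 0)"
      using finite_V by (simp add: sum.inter_filter[symmetric])
  qed
  also have "\<dots> = (\<Sum>w\<in>?K. \<Sum>u\<in>?H. if w \<in> N u then f w else 0)" by (rule sum.swap)
  also have "\<dots> = (\<Sum>w\<in>?K. int m * f w)"
  proof (rule sum.cong[OF refl])
    fix w assume w: "w \<in> ?K"
    then have "N w = {u \<in> ?H. w \<in> N u}" using assms by blast
    then have "(\<Sum>u\<in>?H. if w \<in> N u then f w else 0) = (\<Sum>u\<in>N w. f w)"
      using finite_V by (simp add: sum.inter_filter[symmetric])
    then show "(\<Sum>u\<in>?H. if w \<in> N u then f w else 0) = int m * f w"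
      using assms(2) w by simp
  qed
  finally show ?thesis by (simp add: half_sum_def sum_distrib_left)
qed

lemma half_sum_A: "half_sum (A f) b = int (Suc q) * half_sum f (\<not> b)"
  unfolding A_def[abs_def]
  by (rule half_sum_swap) (use adj_V2 degree adj_sym side_adj in auto)

end

section \<open>The eigenvalue -1 of the excess cycle for even \<open>d\<close>\<close>

locale even_cyclic_excess = cyclic_excess +
  assumes d_even: "even d"
begin

lemma half_sum_E: "half_sum (E f) b = 2 * half_sum f (\<not> b)"
proof -
  have "half_sum (E f) b = int 2 * half_sum f (\<not> b)"
    unfolding E_def[abs_def]
  proof (rule half_sum_swap)
    fix u w assume "u \<in> V" "w \<in> D u (Suc d)"
    then show "u \<in> D w (Suc d) \<and> side w \<noteq> side u"
      using layer_sym[of w u] side_layer[of w u "Suc d"] d_even by auto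
  qed (use layer_V card_antipodal in auto)
  then show ?thesis by simp
qed

text \<open>The opposite side consists of the vertices at odd distance. As \<open>d\<close> is even,
  these distances are the odd ones up to \<open>d - 1\<close>, summed by \<open>P (d - 1)\<close>,
  and \<open>d + 1\<close>, summed by \<open>E\<close>.\<close>

lemma P_plus_E:
  assumes "u \<in> V"
  shows "P (d - 1) f u + E f u = half_sum f (\<not> side u)"
proof -
  have D: "D u (Suc d) = {w \<in> V. dst u w = Suc d}"
    using layer_V[OF assms] layer_iff_dst[OF assms] by blast
  have "P (d - 1) f u + E f u = (\<Sum>w\<in>V. (if dst u w \<le> d - 1 \<and> even (dst u w + (d - 1)) then f w else 0)
      + (if dst u w = Suc d then f w else 0))"
    unfolding P_def E_def D using finite_V by (simp add: sum.distrib sum.inter_filter[symmetric])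
  also have "\<dots> = (\<Sum>w\<in>V. if side w = (\<not> side u) then f w else 0)"
  proof (rule sum.cong[OF refl])
    fix w assume w: "w \<in> V"
    have "side w = (\<not> side u) \<longleftrightarrow> odd (dst u w)" using side_dst[OF assms w] by auto
    moreover have "dst u w \<le> Suc d" using dst_le[OF assms w] .
    moreover have "even (dst u w + (d - 1)) \<longleftrightarrow> odd (dst u w)" using d_even d_pos by simp
    moreover have "dst u w = d \<Longrightarrow> even (dst u w)" using d_even by simp
    moreover have "odd (Suc d)" using d_even by simp
    ultimately show "(if dst u w \<le> d - 1 \<and> even (dst u w + (d - 1)) then f w else 0) +
      (if dst u w = Suc d then f w else 0) = (if side w = (\<not> side u) then f w else 0)"
      using d_pos by (cases "dst u w = Suc d"; cases "dst u w = d") auto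
  qed
  finally show ?thesis using finite_V by (simp add: half_sum_def sum.inter_filter)
qed

definition W :: "('a \<Rightarrow> int) \<Rightarrow> bool" where
  "W f \<longleftrightarrow> (\<forall>u\<in>V. E f u = - f u)"

text \<open>By \<open>half_sum_E\<close> the sum over each side is -2 times the sum over the other,
  so both vanish.\<close>

lemma W_half_sum: "W f \<Longrightarrow> half_sum f b = 0"
proof -
  assume f: "W f"
  have *: "half_sum (E f) b = - half_sum f b" for b
    unfolding half_sum_def sum_negf[symmetric]
    by (rule sum.cong[OF refl]) (use f[unfolded W_def] in blast)
  have "- half_sum f b = 2 * half_sum f (\<not> b)" "- half_sum f (\<not> b) = 2 * half_sum f b"
    using half_sum_E[of f b] half_sum_E[of f "\<not> b"] by (simp_all only: * not_not)
  then show ?thesis by linarith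
qed

lemma W_P:
  assumes "W f" "u \<in> V"
  shows "P (d - 1) f u = f u"
  using P_plus_E[OF assms(2), of f] W_half_sum[OF assms(1)] assms by (simp add: W_def)

text \<open>\<open>P (d - 1)\<close> commutes with \<open>A\<close> and fixes \<open>f\<close>,
  hence fixes \<open>A f\<close>. The half sums of \<open>A f\<close> vanish too, so
  \<open>P_plus_E\<close> returns the eigenvalue equation.\<close>

lemma W_A:
  assumes "W f"
  shows "W (A f)"
  unfolding W_def
proof
  fix u assume u: "u \<in> V"
  have "P (d - 1) (A f) u = A (P (d - 1) f) u" using P_A_commute d_pos u by simp
  also have "\<dots> = A f u" by (rule A_cong) (use W_P assms in blast)
  finally show "E (A f) u = - A f u"
    using P_plus_E[OF u, of "A f"] half_sum_A[of f "\<not> side u"] W_half_sum[OF assms] by simp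
qed

lemma E_c: "E f (c (Suc i)) = f (c i) + f (c (Suc (Suc i)))"
  unfolding E_def c_layer using c_ne[of 2 i] n_ge by simp

lemma W_recurrence: "W f \<Longrightarrow> f (c (Suc (Suc i))) = - f (c i) - f (c (Suc i))"
proof -
  assume "W f"
  then have "E f (c (Suc i)) = - f (c (Suc i))" using c_in_V unfolding W_def by blast
  then show ?thesis using E_c[of f i] by linarith
qed

text \<open>Along the cycle the eigenvalue equation is a recurrence, all of whose solutions have
  period 3.\<close>

lemma W_iff: "W f \<longleftrightarrow> (\<forall>i. f (c (Suc (Suc i))) = - f (c i) - f (c (Suc i)))"
proof
  assume *: "\<forall>i. f (c (Suc (Suc i))) = - f (c i) - f (c (Suc i))"
  show "W f" unfolding W_def
  proof
    fix u assume "u \<in> V"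
    then obtain i where "u = c (Suc i)" by (rule V_c_Suc)
    then show "E f u = - f u" using E_c * by simp
  qed
qed (use W_recurrence in blast)

end

section \<open>An integral basis of the eigenspace and the matrix of \<open>A\<close> on it\<close>

locale three_cyclic_excess = even_cyclic_excess +
  assumes n_3: "3 dvd n"
begin

definition index :: "'a \<Rightarrow> nat" where
  "index x = (SOME i. c i = x)"

text \<open>A position on the cycle is determined only modulo \<open>n\<close>; its residue modulo 3
  is well defined because 3 divides \<open>n\<close>.\<close>

lemma index_c: "index (c i) mod 3 = i mod 3"
proof -
  have "c (index (c i)) = c i" unfolding index_def by (rule someI) (rule refl)
  then show ?thesis using n_3 by (metis c_eq mod_mod_cancel)
qed

text \<open>The patterns 1, 0, -1 of \<open>b1\<close> and 0, 1, -1 of \<open>b2\<close> are the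
  solutions of the recurrence with initial values 1, 0 and 0, 1.\<close>

definition b1 :: "'a \<Rightarrow> int" where
  "b1 x = (if index x mod 3 = 0 then 1 else if index x mod 3 = 1 then 0 else -1)"

definition b2 :: "'a \<Rightarrow> int" where
  "b2 x = (if index x mod 3 = 0 then 0 else if index x mod 3 = 1 then 1 else -1)"

lemma mod3_cases:
  fixes i :: nat
  obtains "i mod 3 = 0" "Suc i mod 3 = 1" "Suc (Suc i) mod 3 = 2"
  | "i mod 3 = 1" "Suc i mod 3 = 2" "Suc (Suc i) mod 3 = 0"
  | "i mod 3 = 2" "Suc i mod 3 = 0" "Suc (Suc i) mod 3 = 1"
proof -
  have "i mod 3 = 0 \<or> i mod 3 = 1 \<or> i mod 3 = 2" by presburger
  then show thesis using that by (elim disjE) (simp_all add: mod_Suc)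
qed

lemma W_b1: "W b1"
  unfolding W_iff
proof
  fix i show "b1 (c (Suc (Suc i))) = - b1 (c i) - b1 (c (Suc i))"
    by (cases rule: mod3_cases[of i]) (simp_all add: b1_def index_c)
qed

lemma W_b2: "W b2"
  unfolding W_iff
proof
  fix i show "b2 (c (Suc (Suc i))) = - b2 (c i) - b2 (c (Suc i))"
    by (cases rule: mod3_cases[of i]) (simp_all add: b2_def index_c)
qed

lemma b_c: "b1 (c 0) = 1" "b2 (c 0) = 0" "b1 (c (Suc 0)) = 0" "b2 (c (Suc 0)) = 1"
  by (simp_all add: b1_def b2_def index_c)

lemma W_basis:
  assumes "W f" "u \<in> V"
  shows "f u = f (c 0) * b1 u + f (c (Suc 0)) * b2 u"
proof -
  obtain i where "u = c i" using V_c assms by blast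
  moreover have "f (c i) = f (c 0) * b1 (c i) + f (c (Suc 0)) * b2 (c i)"
    by (induction i rule: induct_nat_012)
       (simp_all add: b_c W_recurrence assms W_b1 W_b2 algebra_simps)
  ultimately show ?thesis by simp
qed

text \<open>Cayley-Hamilton for the matrix of \<open>A\<close> in the basis \<open>b1\<close>,
  \<open>b2\<close>; its entries are the values of \<open>A b1\<close> and \<open>A b2\<close> at
  \<open>c 0\<close> and \<open>c (Suc 0)\<close>.\<close>

lemma A_A:
  assumes "\<alpha> = A b1 (c 0)" "\<beta> = A b1 (c (Suc 0))" "\<gamma> = A b2 (c 0)" "\<epsilon> = A b2 (c (Suc 0))"
    and "W f" "u \<in> V"
  shows "A (A f) u = (\<alpha> + \<epsilon>) * A f u - (\<alpha> * \<epsilon> - \<beta> * \<gamma>) * f u"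
proof -
  define x y where "x = f (c 0)" and "y = f (c (Suc 0))"
  have A1: "A b1 v = \<alpha> * b1 v + \<beta> * b2 v" and A2: "A b2 v = \<gamma> * b1 v + \<epsilon> * b2 v"
    if "v \<in> V" for v
    using W_basis[OF W_A[OF W_b1] that] W_basis[OF W_A[OF W_b2] that] assms by simp_all
  have f: "f v = x * b1 v + y * b2 v" if "v \<in> V" for v
    using W_basis[OF \<open>W f\<close> that] by (simp add: x_def y_def)
  have Af: "A f v = (x * \<alpha> + y * \<gamma>) * b1 v + (x * \<beta> + y * \<epsilon>) * b2 v" if "v \<in> V" for v
  proof -
    have "A f v = A (\<lambda>v. x * b1 v + y * b2 v) v" by (rule A_cong) (rule f)
    then show ?thesis by (simp add: A_linear A1 A2 that algebra_simps)
  qed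
  have "A (A f) u = A (\<lambda>v. (x * \<alpha> + y * \<gamma>) * b1 v + (x * \<beta> + y * \<epsilon>) * b2 v) u"
    by (rule A_cong) (rule Af)
  then have "A (A f) u = (x * \<alpha> + y * \<gamma>) * A b1 u + (x * \<beta> + y * \<epsilon>) * A b2 u"
    by (simp only: A_linear)
  then show ?thesis
    unfolding A1[OF \<open>u \<in> V\<close>] A2[OF \<open>u \<in> V\<close>] Af[OF \<open>u \<in> V\<close>] f[OF \<open>u \<in> V\<close>]
    by (simp add: algebra_simps)
qed

lemma P_cheb:
  assumes "\<And>u. u \<in> V \<Longrightarrow> A (A f) u = t * A f u - D' * f u"
  shows "i < d \<Longrightarrow> u \<in> V \<Longrightarrow>
    P i f u = fst (cheb t D' (int q) i) * A f u + snd (cheb t D' (int q) i) * f u"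
proof (induction i arbitrary: u rule: induct_nat_012)
  case (ge2 i)
  let ?a = "fst (cheb t D' (int q) (Suc i))" and ?b = "snd (cheb t D' (int q) (Suc i))"
  have "A (P (Suc i) f) u = A (\<lambda>v. ?a * A f v + ?b * f v) u"
    by (rule A_cong) (use ge2 in simp)
  also have "\<dots> = ?a * (t * A f u - D' * f u) + ?b * A f u"
    unfolding A_linear using assms ge2.prems by simp
  finally show ?case
    using P_Suc_Suc[of u i f] ge2 by (simp add: algebra_simps)
qed (simp_all add: P_0 P_1)

theorem no_cyclic_excess: "\<not> (d = 4 \<or> (q mod 3 = 0 \<and> (d = 6 \<or> d = 8)))"
proof
  assume d: "d = 4 \<or> (q mod 3 = 0 \<and> (d = 6 \<or> d = 8))"
  define \<alpha> \<beta> \<gamma> \<epsilon> where "\<alpha> = A b1 (c 0)" and "\<beta> = A b1 (c (Suc 0))"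
    and "\<gamma> = A b2 (c 0)" and "\<epsilon> = A b2 (c (Suc 0))"
  define a b where "a = fst (cheb (\<alpha> + \<epsilon>) (\<alpha> * \<epsilon> - \<beta> * \<gamma>) (int q) (d - 1))"
    and "b = snd (cheb (\<alpha> + \<epsilon>) (\<alpha> * \<epsilon> - \<beta> * \<gamma>) (int q) (d - 1))"
  have "a * A f u + b * f u = f u" if "W f" "u \<in> V" for f u
  proof -
    have "P (d - 1) f u = a * A f u + b * f u"
      unfolding a_def b_def
      by (rule P_cheb) (use A_A[OF \<alpha>_def \<beta>_def \<gamma>_def \<epsilon>_def] that d_pos in auto)
    then show ?thesis using W_P that by simp
  qed
  \<comment> \<open>Evaluating both basis vectors at both base points gives the four entries of
    \<open>a C + b = 1\<close>.\<close>
  from this[OF W_b1, of "c 0"] this[OF W_b1, of "c (Suc 0)"]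
    this[OF W_b2, of "c 0"] this[OF W_b2, of "c (Suc 0)"]
  have eqs: "a * \<alpha> + b = 1" "a * \<beta> = 0" "a * \<gamma> = 0" "a * \<epsilon> + b = 1"
    by (simp_all only: c_in_V b_c \<alpha>_def \<beta>_def \<gamma>_def \<epsilon>_def mult_zero_right mult_1_right add_0_right)
  have d3: "d - 1 = 3 \<or> (int q mod 3 = 0 \<and> (d - 1 = 5 \<or> d - 1 = 7))"
    using d by auto
  have q5: "5 \<le> int q" using q_ge by simp
  show False
    by (rule cheb_matrix_ne_1[OF q5 d3 a_def[symmetric] b_def[symmetric] eqs])
qed

end

section \<open>Graphs of cyclic excess four\<close>

lemma pcas_walk: "a \<le> b \<Longrightarrow> pcas (w a) (map (\<lambda>i. (w i, w (Suc i))) [a..<b]) (w b)"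
  by (induction rule: inc_induct) (simp_all add: upt_conv_Cons)

text \<open>A shortest closed segment of a walk without backtracking is a cycle.\<close>

lemma closed_walk_ucycle:
  assumes "pair_graph G"
    and adj: "\<And>i. i < m \<Longrightarrow> (w i, w (Suc i)) \<in> parcs G"
    and nb: "\<And>i. i + 2 \<le> m \<Longrightarrow> w i \<noteq> w (i + 2)"
    and "0 < m" "w 0 = w m"
  shows "\<exists>p. ucycle G p \<and> length p \<le> m"
proof -
  interpret pair_graph G by fact
  define L where "L = (LEAST l. 0 < l \<and> (\<exists>a. a + l \<le> m \<and> w a = w (a + l)))"
  have "0 < m \<and> (\<exists>a. a + m \<le> m \<and> w a = w (a + m))"
    using assms by (auto intro!: exI[of _ 0])
  then have "0 < L \<and> (\<exists>a. a + L \<le> m \<and> w a = w (a + L))"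
    unfolding L_def by (rule LeastI)
  then obtain a where a: "0 < L" "a + L \<le> m" "w a = w (a + L)" by blast
  have least: "w i \<noteq> w (i + l)" if "0 < l" "l < L" "i + l \<le> m" for i l
    using that not_less_Least[of l "\<lambda>l. 0 < l \<and> (\<exists>a. a + l \<le> m \<and> w a = w (a + l))"]
    unfolding L_def by blast
  have "L \<noteq> 1" using a adj[of a] pair_no_loops[of "(w a, w (Suc a))"] by auto
  moreover have "L \<noteq> 2" using a nb[of a] by auto
  ultimately have L: "3 \<le> L" using a by linarith
  define p where "p = map (\<lambda>i. (w i, w (Suc i))) [a..<a + L]"
  have p: "p \<noteq> []" "length p = L" using L by (simp_all add: p_def)
  have cas: "pcas (w a) p (w a)"
    using pcas_walk[of a "a + L" w] a by (simp add: p_def)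
  have arcs: "set p \<subseteq> parcs G" using adj a by (auto simp: p_def)
  have "w a \<in> pverts G" using adj[of a] a arc_fst_in_verts[of "(w a, w (Suc a))"] by simp
  then have awalk: "pre_digraph.awalk (with_proj G) (w a) p (w a)"
    using cas arcs by (simp add: pre_digraph.awalk_def cas_with_proj_eq)
  have "inj_on (\<lambda>i. w (Suc i)) {a..<a + L}"
  proof (rule linorder_inj_onI)
    fix i j assume ij: "i < j" "i \<in> {a..<a + L}" "j \<in> {a..<a + L}"
    then show "w (Suc i) \<noteq> w (Suc j)" using least[of "j - i" "Suc i"] a by simp
  qed auto
  then have "distinct (map snd p)" by (simp add: p_def distinct_map comp_def)
  moreover have "pre_digraph.cas (with_proj G) (w a) p (w a)"
    using cas by (simp add: cas_with_proj_eq)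
  then have "tl (pre_digraph.awalk_verts (with_proj G) (w a) p) = map snd p"
    using p by (simp only: pre_digraph.awalk_verts_conv') simp
  ultimately have "ucycle G p"
    unfolding ucycle_def pre_digraph.cycle_def using awalk p L by auto
  then show ?thesis using p a by (intro exI[of _ p]) simp
qed

lemma girth_not_closed:
  assumes "pair_graph G" "girth G = enat g"
    and "\<And>i. i < m \<Longrightarrow> (w i, w (Suc i)) \<in> parcs G"
    and "\<And>i. i + 2 \<le> m \<Longrightarrow> w i \<noteq> w (i + 2)"
    and "0 < m" "m < g"
  shows "w 0 \<noteq> w m"
proof
  assume "w 0 = w m"
  then obtain p where p: "ucycle G p" "length p \<le> m"
    using closed_walk_ucycle[OF assms(1,3,4,5)] by blast
  then have "girth G \<le> enat (length p)" unfolding girth_def by (intro INF_lower) simp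
  then show False using assms(2,6) p by simp
qed

lemma (in pair_wf_digraph) relpowp_iff_awalk:
  "u \<in> pverts G \<Longrightarrow> ((\<lambda>x y. (x, y) \<in> parcs G) ^^ i) u v \<longleftrightarrow> (\<exists>p. awalk u p v \<and> length p = i)"
proof (induction i arbitrary: u)
  case 0
  then show ?case by (auto simp: awalk_Nil_iff)
next
  case (Suc i)
  have "((\<lambda>x y. (x, y) \<in> parcs G) ^^ Suc i) u v \<longleftrightarrow>
      (\<exists>z. (u, z) \<in> parcs G \<and> ((\<lambda>x y. (x, y) \<in> parcs G) ^^ i) z v)"
    by (meson relpowp_Suc_D2 relpowp_Suc_I2)
  also have "\<dots> \<longleftrightarrow> (\<exists>z. (u, z) \<in> parcs G \<and> (\<exists>p. awalk z p v \<and> length p = i))"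
    using Suc.IH in_arcsD2 by blast
  also have "\<dots> \<longleftrightarrow> (\<exists>p. awalk u p v \<and> length p = Suc i)"
  proof
    assume "\<exists>z. (u, z) \<in> parcs G \<and> (\<exists>p. awalk z p v \<and> length p = i)"
    then obtain z p where "(u, z) \<in> parcs G" "awalk z p v" "length p = i" by blast
    then have "awalk u ((u, z) # p) v \<and> length ((u, z) # p) = Suc i"
      by (simp add: awalk_Cons_iff)
    then show "\<exists>p. awalk u p v \<and> length p = Suc i" by blast
  next
    assume "\<exists>p. awalk u p v \<and> length p = Suc i"
    then obtain e p where "awalk u (e # p) v" "length p = i" by (auto simp: length_Suc_conv)
    then have "(u, snd e) \<in> parcs G" "awalk (snd e) p v" by (auto simp: awalk_Cons_iff)
    with \<open>length p = i\<close> show "\<exists>z. (u, z) \<in> parcs G \<and> (\<exists>p. awalk z p v \<and> length p = i)"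
      by blast
  qed
  finally show ?case .
qed

text \<open>With unit costs, \<open>udist\<close> is an infimum of walk lengths, attained by the
  shortest walk. This links the excess graph to the layers.\<close>

lemma (in pair_wf_digraph) udist_eq_iff_layer:
  assumes "u \<in> pverts G"
  shows "udist G u v = ereal (real i) \<longleftrightarrow> v \<in> layer (\<lambda>x y. (x, y) \<in> parcs G) u i"
proof -
  let ?R = "\<lambda>x y. (x, y) \<in> parcs G"
  have cost: "awalk_cost (\<lambda>_. 1) p = real (length p)" for p
    by (simp add: awalk_cost_def sum_list_triv)
  have eq: "udist G u v = (INF p\<in>{p. awalk u p v}. ereal (real (length p)))"
    unfolding udist_def \<mu>_def cost ..
  have layer: "udist G u v = ereal (real j)" if "v \<in> layer ?R u j" for j
    unfolding eq
  proof (rule INF_eqI)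
    fix p assume "p \<in> {p. awalk u p v}"
    then have "(?R ^^ length p) u v" using relpowp_iff_awalk[OF assms] by blast
    then have "j \<le> length p" using that by (auto simp: layer_def not_less[symmetric])
    then show "ereal (real j) \<le> ereal (real (length p))" by simp
  next
    fix y assume y: "\<And>p. p \<in> {p. awalk u p v} \<Longrightarrow> y \<le> ereal (real (length p))"
    have "(?R ^^ j) u v" using that by (simp add: layer_def)
    then obtain p where "awalk u p v" "length p = j" using relpowp_iff_awalk[OF assms] by blast
    then show "y \<le> ereal (real j)" using y by blast
  qed
  show ?thesis
  proof
    assume i: "udist G u v = ereal (real i)"
    \<comment> \<open>An empty infimum would be infinite.\<close>
    have "{p. awalk u p v} \<noteq> {}"
    proof
      assume "{p. awalk u p v} = {}"
      then show False using i unfolding eq by (simp add: top_ereal_def)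
    qed
    then obtain m where "(?R ^^ m) u v" using relpowp_iff_awalk[OF assms] by blast
    then obtain j where "v \<in> layer ?R u j" by (rule relpowp_layer)
    then show "v \<in> layer ?R u i" using layer[of j] i by simp
  qed (rule layer)
qed

lemma pcas_nth: "pcas u p v \<Longrightarrow> i < length p \<Longrightarrow> fst (p ! i) = (if i = 0 then u else snd (p ! (i - 1)))"
  by (induction u p v arbitrary: i rule: pcas.induct) (auto simp: nth_Cons split: nat.splits)

lemma pcas_last: "pcas u p v \<Longrightarrow> p \<noteq> [] \<Longrightarrow> snd (last p) = v"
  by (induction u p v rule: pcas.induct) auto

lemma is_cycle_graph_enum:
  assumes "is_cycle_graph n H"
  obtains c :: "nat \<Rightarrow> 'a" where "\<And>i j. c i = c j \<longleftrightarrow> i mod n = j mod n"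
    and "parcs H = range (\<lambda>i. (c i, c (Suc i))) \<union> range (\<lambda>i. (c (Suc i), c i))" and "0 < n"
proof -
  obtain p u where p: "length p = n" "3 \<le> length p" "parcs H = set p \<union> (set p)\<inverse>"
    and u: "pcas u p u" "distinct (tl (pre_digraph.awalk_verts (with_proj H) u p))"
    using assms
    by (auto simp: is_cycle_graph_def ucycle_def pre_digraph.cycle_def pre_digraph.awalk_def
        cas_with_proj_eq)
  have n: "0 < n" using p by linarith
  then have ne: "p \<noteq> []" using p by auto
  have "pre_digraph.cas (with_proj H) u p u" using u by (simp add: cas_with_proj_eq)
  then have "tl (pre_digraph.awalk_verts (with_proj H) u p) = map snd p"
    using ne by (simp only: pre_digraph.awalk_verts_conv') simp
  then have dist: "distinct (map snd p)" using u by simp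
  \<comment> \<open>\<open>c i\<close> is the head of the arc at position \<open>i\<close> and hence
    the tail of the next one; the indices modulo \<open>n\<close> join the last arc to the
    first.\<close>
  define c where "c i = snd (p ! (i mod n))" for i
  have c_eq: "c i = c j \<longleftrightarrow> i mod n = j mod n" for i j
    using nth_eq_iff_index_eq[OF dist, of "i mod n" "j mod n"] n p by (simp add: c_def)
  have arc: "p ! (Suc i mod n) = (c i, c (Suc i))" for i
  proof -
    have "fst (p ! (Suc i mod n)) = c i"
    proof (cases "Suc i mod n = 0")
      case True
      then have "i mod n = n - 1" using n by (simp add: mod_Suc split: if_splits)
      then have "c i = snd (last p)" using p ne by (simp add: c_def last_conv_nth)
      then show ?thesis using pcas_nth[OF u(1), of 0] pcas_last[OF u(1) ne] True n p by simp
    next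
      case False
      then have "Suc i mod n = Suc (i mod n)" by (simp add: mod_Suc split: if_splits)
      moreover have "Suc i mod n < n" using n by simp
      ultimately show ?thesis
        using pcas_nth[OF u(1), of "Suc (i mod n)"] p(1) by (simp add: c_def)
    qed
    then show ?thesis by (simp add: c_def prod_eq_iff)
  qed
  have "set p = range (\<lambda>i. (c i, c (Suc i)))"
  proof (intro equalityI subsetI)
    fix e assume "e \<in> set p"
    then obtain i where i: "i < n" "e = p ! i" using p by (metis in_set_conv_nth)
    \<comment> \<open>Shifting by \<open>n - 1\<close> writes every position as a successor modulo
      \<open>n\<close>.\<close>
    then have "e = p ! (Suc (i + n - 1) mod n)" using n by simp
    then show "e \<in> range (\<lambda>i. (c i, c (Suc i)))" unfolding arc by blast
  next
    fix e assume "e \<in> range (\<lambda>i. (c i, c (Suc i)))"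
    then obtain i where "e = p ! (Suc i mod n)" using arc by auto
    then show "e \<in> set p" using n p by simp
  qed
  then have "parcs H = range (\<lambda>i. (c i, c (Suc i))) \<union> range (\<lambda>i. (c (Suc i), c i))"
    unfolding p by auto
  with c_eq n show thesis by (intro that)
qed

lemma cyclic_excess_4_locale:
  assumes ex: "cyclic_excess_4 (Suc q) (2 * d) G" and "5 \<le> q" "2 \<le> d"
  obtains c where "cyclic_excess (pverts G) (\<lambda>x y. (x, y) \<in> parcs G) q d c (card (pverts G))"
proof -
  let ?adj = "\<lambda>x y. (x, y) \<in> parcs G" and ?V = "pverts G" and ?H = "excess_graph (2 * d) G"
  have kg: "pair_graph G" "regular (Suc q) G" "girth G = enat (2 * d)"
    and e4: "excess (Suc q) (2 * d) G = 4" and cyc: "is_cycle_graph (card ?V) ?H"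
    using ex by (auto simp: cyclic_excess_4_def kg_graph_def)
  interpret pair_graph G by fact
  interpret no_short_cycles ?V ?adj q d
  proof
    show "finite ?V" by (rule pair_finite_verts)
    show "x \<in> ?V" if "?adj x y" for x y using that in_arcsD1 by blast
    show "?adj y x" if "?adj x y" for x y
      using that pair_sym_arcs by (simp add: symmetric_def symD)
    show "card {y. ?adj x y} = Suc q" if "x \<in> ?V" for x
    proof -
      have "out_degree (with_proj G) x = card (snd ` out_arcs (with_proj G) x)"
        unfolding out_degree_def
        by (rule card_image[symmetric]) (auto simp: inj_on_def out_arcs_def)
      also have "snd ` out_arcs (with_proj G) x = {y. ?adj x y}"
        by (force simp: out_arcs_def image_iff)
      finally show ?thesis using kg(2) that by (simp add: regular_def)
    qed
  qed (use girth_not_closed[OF kg(1,3)] assms in auto)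
  obtain c where c: "\<And>i j. c i = c j \<longleftrightarrow> i mod card ?V = j mod card ?V"
    "parcs ?H = range (\<lambda>i. (c i, c (Suc i))) \<union> range (\<lambda>i. (c (Suc i), c i))" "0 < card ?V"
    using is_cycle_graph_enum[OF cyc] by blast
  have H: "parcs ?H = {(u, v). u \<in> ?V \<and> v \<in> D u (Suc d)}"
    using udist_eq_iff_layer[of _ _ "Suc d"] layer_V by (auto simp: excess_graph_def)
  have c_V: "c i \<in> ?V" for i
    using c(2) H by blast
  have "range c = ?V"
  proof (rule card_seteq[OF finite_V])
    \<comment> \<open>One period of \<open>c\<close> already takes as many values as there are
      vertices, so \<open>c\<close> is onto.\<close>
    have "inj_on c {..<card ?V}" by (auto simp: inj_on_def c(1))
    then have "card ?V = card (c ` {..<card ?V})" by (simp add: card_image)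
    also have "\<dots> \<le> card (range c)"
      by (rule card_mono[OF finite_subset[OF _ finite_V]]) (use c_V in auto)
    finally show "card ?V \<le> card (range c)" .
  qed (use c_V in blast)
  moreover have "D (c (Suc i)) (Suc d) = {c i, c (Suc (Suc i))}" for i
  proof -
    have "w \<in> D (c (Suc i)) (Suc d) \<longleftrightarrow> w = c i \<or> w = c (Suc (Suc i))" for w
    proof -
      have "w \<in> D (c (Suc i)) (Suc d) \<longleftrightarrow> (c (Suc i), w) \<in> parcs ?H" using H c_V by auto
      \<comment> \<open>The two orientations of the cycle contribute the successor and the
        predecessor.\<close>
      also have "\<dots> \<longleftrightarrow> (\<exists>j. c (Suc i) = c j \<and> w = c (Suc j)) \<or> (\<exists>j. c (Suc i) = c (Suc j) \<and> w = c j)"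
        unfolding c(2) by auto
      also have "\<dots> \<longleftrightarrow> w = c i \<or> w = c (Suc (Suc i))"
        using c(1) mod_add_rcancel_nat[of _ 1 "card ?V"] by (metis Suc_eq_plus1)
      finally show ?thesis .
    qed
    then show ?thesis by blast
  qed
  moreover have "int (card ?V) = int (2 * (\<Sum>i<d. q ^ i) + 4)"
    using e4 by (simp add: excess_def moore_bound_def)
  then have "card ?V = 2 * (\<Sum>i<d. q ^ i) + 4" by (simp only: of_nat_eq_iff)
  ultimately have "cyclic_excess ?V ?adj q d c (card ?V)"
    using c(1) assms by unfold_locales auto
  then show thesis by (rule that)
qed

section \<open>Residues modulo 3 and the conclusion\<close>

lemma sum_power_mod: "(\<Sum>i<m. q ^ i) mod 3 = (\<Sum>i<m. (q mod 3) ^ i) mod 3" for q :: nat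
  by (subst (1 2) mod_sum_eq[symmetric]) (simp add: power_mod)

text \<open>The power sum is 1 modulo 3 in both cases: either only the term \<open>i = 0\<close>
  survives, or four terms equal 1. The order is then \<open>2 + 4\<close>, that is 0, modulo
  3.\<close>

lemma three_dvd_order:
  fixes q d :: nat
  assumes "(q mod 3 = 0 \<and> 0 < d) \<or> (q mod 3 = 1 \<and> d = 4)"
  shows "3 dvd 2 * (\<Sum>i<d. q ^ i) + 4"
proof -
  have "(\<Sum>i<d. q ^ i) mod 3 = 1"
    using assms
  proof
    assume *: "q mod 3 = 0 \<and> 0 < d"
    then obtain m where "d = Suc m" by (cases d) auto
    then have "(\<Sum>i<d. (0::nat) ^ i) = 1" by (simp only: sum.lessThan_Suc_shift) simp
    then show ?thesis unfolding sum_power_mod[of q] using * by simp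
  next
    assume "q mod 3 = 1 \<and> d = 4"
    then show ?thesis unfolding sum_power_mod[of q] by simp
  qed
  moreover have "3 dvd 2 * s + 4" if "s mod 3 = 1" for s :: nat using that by presburger
  ultimately show ?thesis by blast
qed

theorem theorem3p3:
  fixes k g :: nat
  assumes "k \<ge> 6"
    and "((k mod 3 = 1 \<or> k mod 3 = 2) \<and> g = 8) \<or>
         (k mod 3 = 1 \<and> g = 12) \<or>
         (k mod 3 = 1 \<and> g = 16)"
  shows "\<not> (\<exists>G :: 'a pair_pre_digraph. cyclic_excess_4 k g G)"
proof
  assume "\<exists>G :: 'a pair_pre_digraph. cyclic_excess_4 k g G"
  then obtain G :: "'a pair_pre_digraph" where G: "cyclic_excess_4 k g G" ..
  define q d where "q = k - 1" and "d = g div 2"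
  have k: "k = Suc q" "5 \<le> q" using assms(1) by (simp_all add: q_def)
  \<comment> \<open>The residues 1 and 2 of \<open>k\<close> become 0 and 1 for \<open>q\<close>,
    and the girths 8, 12, 16 become 4, 6, 8 for \<open>d\<close>.\<close>
  have "q mod 3 = 0" if "k mod 3 = 1" using that k by presburger
  moreover have "q mod 3 = 1" if "k mod 3 = 2" using that k by presburger
  ultimately have d: "g = 2 * d" "2 \<le> d" "even d" "d = 4 \<or> (q mod 3 = 0 \<and> (d = 6 \<or> d = 8))"
    and q: "(q mod 3 = 0 \<and> 0 < d) \<or> (q mod 3 = 1 \<and> d = 4)"
    using assms(2) by (auto simp: d_def)
  obtain c where "cyclic_excess (pverts G) (\<lambda>x y. (x, y) \<in> parcs G) q d c (card (pverts G))"
    using cyclic_excess_4_locale[of q d G] G k d by auto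
  then interpret cyclic_excess "pverts G" "\<lambda>x y. (x, y) \<in> parcs G" q d c "card (pverts G)" .
  interpret three_cyclic_excess "pverts G" "\<lambda>x y. (x, y) \<in> parcs G" q d c "card (pverts G)"
  proof
    show "3 dvd card (pverts G)" using three_dvd_order[OF q] by (simp only: card_V)
  qed (rule d)
  show False using no_cyclic_excess d by blast
qed

end
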